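(* Let $p$ be an odd prime and let $G$ be a finite $p$-group such that $G_3\cong C_p$, $\Phi(G')G_3\cong C_p^2$, $G/\Phi(G')G_3\cong M_p(n,m,1)$ and the type of the abelian group $C_G(G')/\Phi(G')G_3$ is $(p^{n-1},p^m,p)$, where $n>m$. Let $w(G)=(w_{ij})$ be a characteristic matrix of $G$ and let $|w(G)|$ be its determinant. Then: (1) $I_{\min}\ge2$; that is, $G$ does not have an $\mathcal{A}_1$-subgroup of index $p$. (2) $I_{\max}\ge m$. (3) $I_{\max}=2$ if and only if $m=2$ and one of the following conditions holds: (i) $w_{12}\ne0$ and $w_{11}|w(G)|\ne w_{12}^2$; (ii) $w_{12}=0$, $w_{11}\ne0$ and $w_{22}\ne0$; (iii) $w_{21}^2+4w_{22}$ is a quadratic non-residue modulo $p$.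
   Context: All groups are finite $p$-groups; $G_3=[G',G]$, $\Phi(H)$ is the Frattini subgroup of $H$, $[x,y]=x^{-1}y^{-1}xy$. An $\mathcal{A}_1$-group is a minimal non-abelian $p$-group. For a finite non-abelian $p$-group $G$, $p^{I_{\min}}$ and $p^{I_{\max}}$ denote the minimal and the maximal index in $G$ of the $\mathcal{A}_1$-subgroups of $G$. $M_p(n,m,1)=\langle a,b,c\mid a^{p^n}=b^{p^m}=c^p=1,\ [a,b]=c,\ [c,a]=[c,b]=1\rangle$. An abelian group has type $(p^{e_1},p^{e_2},p^{e_3})$ if it is isomorphic to $C_{p^{e_1}}\times C_{p^{e_2}}\times C_{p^{e_3}}$. Characteristic matrix: choose $a,b\in G$ whose images $\tilde a,\tilde b$ in $G/\Phi(G')G_3\cong M_p(n,m,1)$ are generators satisfying, with $\tilde c=[\tilde a,\tilde b]$, the relations $\tilde a^{p^n}=\tilde b^{p^m}=\tilde c^p=1$, $[\tilde c,\tilde a]=[\tilde c,\tilde b]=1$ (image of $a$ of order $p^n$, image of $b$ of order $p^m$); put $c=[a,b]$. In the present case $[b,c]=1$ and $[a,c]\ne1$. Put $y=[a,c]$, so $G_3=\langle y\rangle$; $c$ has order $p^2$ and $\Phi(G')G_3=\langle c^p\rangle\times\langle y\rangle$. There are $w_{ij}\in F_p$ (the field with $p$ elements) with $a^{p^n}=c^{w_{11}p}y^{w_{12}}$ and $b^{p^m}=c^{w_{21}p}y^{w_{22}}$. The matrix $w(G)=(w_{ij})$ is called a characteristic matrix of $G$ (it depends on the choice of $a,b$).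 *)

theory Defs
  imports
    "HOL-Algebra.Algebra"
    "HOL-Analysis.Determinants"
    "HOL-Number_Theory.Residues"
begin

section \<open>Groups given by a presentation\<close>

text \<open>Words in the letters of a type and their formal inverses; the letter
  \<open>(True, x)\<close> stands for \<open>x\<close> and \<open>(False, x)\<close> for its formal inverse.\<close>

type_synonym 'x word = "(bool \<times> 'x) list"

definition gen :: "'x \<Rightarrow> 'x word" where
  "gen x = [(True, x)]"

definition word_inv :: "'x word \<Rightarrow> 'x word" where
  "word_inv w = rev (map (\<lambda>(s, x). (\<not> s, x)) w)"

definition word_pow :: "'x word \<Rightarrow> nat \<Rightarrow> 'x word" where
  "word_pow w k = concat (replicate k w)"

definition word_comm :: "'x word \<Rightarrow> 'x word \<Rightarrow> 'x word" where
  "word_comm u v = word_inv u @ word_inv v @ u @ v"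

text \<open>The smallest congruence on words that contains free cancellation and the
  relations \<open>u = v\<close> for \<open>(u, v) \<in> R\<close>.\<close>

inductive pres_eq :: "('x word \<times> 'x word) set \<Rightarrow> 'x word \<Rightarrow> 'x word \<Rightarrow> bool"
  for R :: "('x word \<times> 'x word) set" where
  rel: "(u, v) \<in> R \<Longrightarrow> pres_eq R u v"
| cancel: "pres_eq R [(s, x), (\<not> s, x)] []"
| refl: "pres_eq R u u"
| sym: "pres_eq R u v \<Longrightarrow> pres_eq R v u"
| trans: "pres_eq R u v \<Longrightarrow> pres_eq R v w \<Longrightarrow> pres_eq R u w"
| append: "pres_eq R u u' \<Longrightarrow> pres_eq R v v' \<Longrightarrow> pres_eq R (u @ v) (u' @ v')"

definition pres_class :: "('x word \<times> 'x word) set \<Rightarrow> 'x word \<Rightarrow> 'x word set" where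
  "pres_class R u = {v. pres_eq R u v}"

definition presented_group :: "('x word \<times> 'x word) set \<Rightarrow> 'x word set monoid" where
  "presented_group R =
     \<lparr>carrier = range (pres_class R),
      monoid.mult = (\<lambda>A B. \<Union>u\<in>A. \<Union>v\<in>B. pres_class R (u @ v)),
      one = pres_class R []\<rparr>"

lemma pres_class_eq_iff: "pres_class R u = pres_class R v \<longleftrightarrow> pres_eq R u v"
  unfolding pres_class_def set_eq_iff mem_Collect_eq
  by (meson pres_eq.refl pres_eq.sym pres_eq.trans)

lemma pres_class_mult:
  "pres_class R u \<otimes>\<^bsub>presented_group R\<^esub> pres_class R v = pres_class R (u @ v)"
proof -
  have *: "pres_class R (u' @ v') = pres_class R (u @ v)"
    if "u' \<in> pres_class R u" "v' \<in> pres_class R v" for u' v'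
  proof -
    have "pres_eq R u u'" "pres_eq R v v'"
      using that by (simp_all add: pres_class_def)
    then show ?thesis
      unfolding pres_class_eq_iff by (rule pres_eq.sym[OF pres_eq.append])
  qed
  have "u \<in> pres_class R u" "v \<in> pres_class R v"
    by (simp_all add: pres_class_def pres_eq.refl)
  then have "(\<Union>u'\<in>pres_class R u. \<Union>v'\<in>pres_class R v. pres_class R (u' @ v')) = pres_class R (u @ v)"
    using * by blast
  then show ?thesis
    by (simp add: presented_group_def)
qed

lemma pres_eq_word_inv: "pres_eq R (word_inv u @ u) []"
proof (induction u)
  case Nil
  show ?case by (simp add: word_inv_def pres_eq.refl)
next
  case (Cons l u)
  obtain s x where l: "l = (s, x)" by fastforce
  have "pres_eq R [(\<not> s, x), (s, x)] []"
    using pres_eq.cancel[of R "\<not> s" x] by simp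
  then have "pres_eq R (([(\<not> s, x), (s, x)]) @ u) ([] @ u)"
    by (rule pres_eq.append[OF _ pres_eq.refl])
  then have "pres_eq R (word_inv u @ ([(\<not> s, x), (s, x)] @ u)) (word_inv u @ ([] @ u))"
    by (rule pres_eq.append[OF pres_eq.refl])
  then have "pres_eq R (word_inv (l # u) @ l # u) (word_inv u @ u)"
    by (simp add: word_inv_def l)
  then show ?case
    using Cons.IH by (rule pres_eq.trans)
qed

lemma group_presented_group: "group (presented_group R)"
proof (rule groupI)
  show "\<one>\<^bsub>presented_group R\<^esub> \<in> carrier (presented_group R)"
    by (simp add: presented_group_def)
next
  fix A assume A: "A \<in> carrier (presented_group R)"
  then obtain u where u: "A = pres_class R u" by (auto simp: presented_group_def)
  have one: "\<one>\<^bsub>presented_group R\<^esub> = pres_class R []" by (simp add: presented_group_def)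
  show "\<one>\<^bsub>presented_group R\<^esub> \<otimes>\<^bsub>presented_group R\<^esub> A = A"
    by (simp add: one u pres_class_mult)
  have "pres_class R (word_inv u) \<otimes>\<^bsub>presented_group R\<^esub> A = \<one>\<^bsub>presented_group R\<^esub>"
    by (simp add: one u pres_class_mult pres_class_eq_iff pres_eq_word_inv)
  moreover have "pres_class R (word_inv u) \<in> carrier (presented_group R)"
    by (simp add: presented_group_def)
  ultimately show "\<exists>B\<in>carrier (presented_group R).
      B \<otimes>\<^bsub>presented_group R\<^esub> A = \<one>\<^bsub>presented_group R\<^esub>"
    by blast
next
  fix A B assume "A \<in> carrier (presented_group R)" "B \<in> carrier (presented_group R)"
  then obtain u v where uv: "A = pres_class R u" "B = pres_class R v"
    by (auto simp: presented_group_def)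
  have "A \<otimes>\<^bsub>presented_group R\<^esub> B = pres_class R (u @ v)"
    by (simp add: uv pres_class_mult)
  then show "A \<otimes>\<^bsub>presented_group R\<^esub> B \<in> carrier (presented_group R)"
    by (simp add: presented_group_def)
next
  fix A B C
  assume "A \<in> carrier (presented_group R)" "B \<in> carrier (presented_group R)"
    "C \<in> carrier (presented_group R)"
  then obtain u v w where "A = pres_class R u" "B = pres_class R v" "C = pres_class R w"
    by (auto simp: presented_group_def)
  then show "A \<otimes>\<^bsub>presented_group R\<^esub> B \<otimes>\<^bsub>presented_group R\<^esub> C =
      A \<otimes>\<^bsub>presented_group R\<^esub> (B \<otimes>\<^bsub>presented_group R\<^esub> C)"
    by (simp add: pres_class_mult)
qed

datatype gen3 = GA | GB | GC

text \<open>\<open>Mp1 p n m\<close> is the group usually written \<open>M_p(n, m, 1)\<close>.\<close>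

definition Mp1 :: "nat \<Rightarrow> nat \<Rightarrow> nat \<Rightarrow> gen3 word set monoid" where
  "Mp1 p n m = presented_group
     {(word_pow (gen GA) (p ^ n), []),
      (word_pow (gen GB) (p ^ m), []),
      (word_pow (gen GC) p, []),
      (word_comm (gen GA) (gen GB), gen GC),
      (word_comm (gen GC) (gen GA), []),
      (word_comm (gen GC) (gen GB), [])}"


section \<open>Commutators, Frattini subgroup, centralizer\<close>

text \<open>The convention \<open>[x, y] = x\<^sup>-\<^sup>1 y\<^sup>-\<^sup>1 x y\<close>; \<^const>\<open>derived\<close> uses the other
  common convention, which yields the same derived subgroup.\<close>

definition commutator :: "('a, 'b) monoid_scheme \<Rightarrow> 'a \<Rightarrow> 'a \<Rightarrow> 'a" where
  "commutator G x y = inv\<^bsub>G\<^esub> x \<otimes>\<^bsub>G\<^esub> inv\<^bsub>G\<^esub> y \<otimes>\<^bsub>G\<^esub> x \<otimes>\<^bsub>G\<^esub> y"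

abbreviation derived_subgroup :: "('a, 'b) monoid_scheme \<Rightarrow> 'a set" where
  "derived_subgroup G \<equiv> derived G (carrier G)"

definition gamma3 :: "('a, 'b) monoid_scheme \<Rightarrow> 'a set" where
  "gamma3 G = generate G {commutator G x y | x y. x \<in> derived_subgroup G \<and> y \<in> carrier G}"

definition maximal_subgroup :: "'a set \<Rightarrow> ('a, 'b) monoid_scheme \<Rightarrow> bool" where
  "maximal_subgroup M G \<longleftrightarrow> subgroup M G \<and> M \<noteq> carrier G \<and>
     (\<forall>H. subgroup H G \<longrightarrow> M \<subseteq> H \<longrightarrow> H = M \<or> H = carrier G)"

definition frattini :: "('a, 'b) monoid_scheme \<Rightarrow> 'a set" where
  "frattini G = carrier G \<inter> \<Inter>{M. maximal_subgroup M G}"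

definition centralizer :: "('a, 'b) monoid_scheme \<Rightarrow> 'a set \<Rightarrow> 'a set" where
  "centralizer G H = {g \<in> carrier G. \<forall>h\<in>H. g \<otimes>\<^bsub>G\<^esub> h = h \<otimes>\<^bsub>G\<^esub> g}"

text \<open>The normal subgroup \<open>\<Phi>(G')G\<^sub>3\<close>.\<close>

definition frattini_gamma3 :: "('a, 'b) monoid_scheme \<Rightarrow> 'a set" where
  "frattini_gamma3 G = frattini (G\<lparr>carrier := derived_subgroup G\<rparr>) <#>\<^bsub>G\<^esub> gamma3 G"


section \<open>Minimal non-abelian subgroups\<close>

definition finite_p_group :: "nat \<Rightarrow> ('a, 'b) monoid_scheme \<Rightarrow> bool" where
  "finite_p_group p G \<longleftrightarrow> group G \<and> finite (carrier G) \<and> (\<exists>k. order G = p ^ k)"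

definition A1_group :: "nat \<Rightarrow> ('a, 'b) monoid_scheme \<Rightarrow> bool" where
  "A1_group p G \<longleftrightarrow> finite_p_group p G \<and> \<not> comm_group G \<and>
     (\<forall>H. subgroup H G \<longrightarrow> H \<noteq> carrier G \<longrightarrow> comm_group (G\<lparr>carrier := H\<rparr>))"

definition A1_subgroup :: "nat \<Rightarrow> 'a set \<Rightarrow> ('a, 'b) monoid_scheme \<Rightarrow> bool" where
  "A1_subgroup p H G \<longleftrightarrow> subgroup H G \<and> A1_group p (G\<lparr>carrier := H\<rparr>)"

definition A1_indices :: "nat \<Rightarrow> ('a, 'b) monoid_scheme \<Rightarrow> nat set" where
  "A1_indices p G = {card (rcosets\<^bsub>G\<^esub> H) | H. A1_subgroup p H G}"

definition I_min :: "nat \<Rightarrow> ('a, 'b) monoid_scheme \<Rightarrow> nat" where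
  "I_min p G = (THE i. p ^ i = Min (A1_indices p G))"

definition I_max :: "nat \<Rightarrow> ('a, 'b) monoid_scheme \<Rightarrow> nat" where
  "I_max p G = (THE i. p ^ i = Max (A1_indices p G))"


section \<open>Characteristic matrices\<close>

text \<open>Images in the quotient by \<open>\<Phi>(G')G\<^sub>3\<close> of \<open>a, b\<close> that generate it and satisfy the
  defining relations of \<open>M_p(n, m, 1)\<close>.\<close>

definition char_generators ::
    "nat \<Rightarrow> nat \<Rightarrow> nat \<Rightarrow> ('a, 'b) monoid_scheme \<Rightarrow> 'a \<Rightarrow> 'a \<Rightarrow> bool" where
  "char_generators p n m G a b \<longleftrightarrow> a \<in> carrier G \<and> b \<in> carrier G \<and>
     (let K = frattini_gamma3 G; Q = G Mod K;
          a' = K #>\<^bsub>G\<^esub> a; b' = K #>\<^bsub>G\<^esub> b; c' = commutator Q a' b'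
      in generate Q {a', b'} = carrier Q \<and>
         group.ord Q a' = p ^ n \<and> group.ord Q b' = p ^ m \<and>
         a' [^]\<^bsub>Q\<^esub> (p ^ n) = \<one>\<^bsub>Q\<^esub> \<and> b' [^]\<^bsub>Q\<^esub> (p ^ m) = \<one>\<^bsub>Q\<^esub> \<and> c' [^]\<^bsub>Q\<^esub> p = \<one>\<^bsub>Q\<^esub> \<and>
         commutator Q c' a' = \<one>\<^bsub>Q\<^esub> \<and> commutator Q c' b' = \<one>\<^bsub>Q\<^esub>)"

text \<open>Entries in the field with \<open>p\<close> elements are given by arbitrary integer representatives;
  all statements about them are read modulo \<open>p\<close>.  The powers below depend only on the residue
  classes when \<open>c\<close> has order dividing \<open>p\<^sup>2\<close> and \<open>y\<close> has order dividing \<open>p\<close>.\<close>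

definition characteristic_matrix ::
    "nat \<Rightarrow> nat \<Rightarrow> nat \<Rightarrow> ('a, 'b) monoid_scheme \<Rightarrow> int^2^2 \<Rightarrow> bool" where
  "characteristic_matrix p n m G w \<longleftrightarrow> (\<exists>a b. char_generators p n m G a b \<and>
     (let c = commutator G a b; y = commutator G a c
      in a [^]\<^bsub>G\<^esub> (p ^ n) = c [^]\<^bsub>G\<^esub> (w$1$1 * int p) \<otimes>\<^bsub>G\<^esub> y [^]\<^bsub>G\<^esub> (w$1$2) \<and>
         b [^]\<^bsub>G\<^esub> (p ^ m) = c [^]\<^bsub>G\<^esub> (w$2$1 * int p) \<otimes>\<^bsub>G\<^esub> y [^]\<^bsub>G\<^esub> (w$2$2)))"

end

theory Submission imports Defs
begin

text \<open>
  Put \<open>c = [a, b]\<close> and \<open>y = [a, c]\<close>. The hypotheses force \<open>[b, c] = 1\<close>, so \<open>B = \<langle>b, c, y\<rangle>\<close> is an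
  abelian normal subgroup with \<open>G = \<langle>a\<rangle>B\<close>, on which \<open>a\<close> acts unipotently; computations reduce to
  integer arithmetic with the exponents of \<open>a\<^sup>ib\<^sup>jc\<^sup>ky\<^sup>l\<close>.

  Two non-commuting elements whose commutator is central of order \<open>p\<close> generate an
  \<open>\<A>\<^sub>1\<close>-subgroup. Conversely an \<open>\<A>\<^sub>1\<close>-subgroup is \<open>\<langle>x, z\<rangle>\<close> with \<open>x \<in> a\<^sup>eB\<close>, \<open>z \<in> B\<close> and
  \<open>[x, [x, z]] = 1\<close>, which puts \<open>[x, z]\<close> into \<open>K = \<langle>c\<^sup>p\<rangle> \<times> \<langle>y\<rangle>\<close>; its index then depends only on the
  orders of \<open>x\<close> and \<open>z\<close> modulo \<open>K\<close> and on how much of \<open>K\<close> it contains. The subgroup \<open>\<langle>a, c\<rangle>\<close>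
  has index \<open>p\<^sup>m\<close>.

  Let \<open>m = 2\<close>. An \<open>\<A>\<^sub>1\<close>-subgroup containing \<open>K\<close> has index \<open>p\<^sup>2\<close>, and all of them contain \<open>K\<close>
  unless, for some \<open>t\<close>, the vectors \<open>(w\<^sub>1\<^sub>1, w\<^sub>1\<^sub>2)\<close> and \<open>(w\<^sub>2\<^sub>1 + t, w\<^sub>2\<^sub>2)\<close> are multiples of \<open>(1, t)\<close>; in
  that case \<open>\<langle>a, b\<^sup>pc\<^sup>t\<rangle>\<close> meets \<open>K\<close> in a subgroup of order \<open>p\<close> and has index \<open>p\<^sup>3\<close>. The conditions
  (i), (ii), (iii) say that \<open>w\<^sub>1\<^sub>2 = t w\<^sub>1\<^sub>1\<close> and \<open>w\<^sub>2\<^sub>2 = t(w\<^sub>2\<^sub>1 + t)\<close> have no common solution \<open>t\<close>.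
\<close>

section \<open>Heisenberg triples\<close>

lemma (in group) inv_cancel_left [simp]:
  assumes "g \<in> carrier G" "h \<in> carrier G"
  shows "inv g \<otimes> (g \<otimes> h) = h" "g \<otimes> (inv g \<otimes> h) = h"
  using assms by (simp_all add: m_assoc[symmetric])

lemma (in group) conj_int_pow:
  assumes [simp]: "g \<in> carrier G" "h \<in> carrier G"
  shows "(inv g \<otimes> h \<otimes> g) [^] (i::int) = inv g \<otimes> h [^] i \<otimes> g"
proof -
  have "(\<lambda>h. inv g \<otimes> h \<otimes> g) \<in> hom G G"
  proof (rule homI)
    fix s t assume [simp]: "s \<in> carrier G" "t \<in> carrier G"
    show "inv g \<otimes> (s \<otimes> t) \<otimes> g = inv g \<otimes> s \<otimes> g \<otimes> (inv g \<otimes> t \<otimes> g)"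
      by (simp add: m_assoc)
  qed simp
  from hom_int_pow[OF this] show ?thesis by (simp add: is_group)
qed

lemma (in group) conj_eq_iff:
  assumes "g \<in> carrier G" "h \<in> carrier G" "k \<in> carrier G"
  shows "inv g \<otimes> h \<otimes> g = k \<longleftrightarrow> h \<otimes> g = g \<otimes> k"
  using assms by (metis inv_closed inv_solve_left m_assoc m_closed)

lemma (in group) int_pow_comm:
  assumes "g \<in> carrier G" "h \<in> carrier G" "g \<otimes> h = h \<otimes> g"
  shows "g [^] (i::int) \<otimes> h = h \<otimes> g [^] i"
  using conj_int_pow[of h g i] conj_eq_iff[of h g g] conj_eq_iff[of h "g [^] i" "g [^] i"] assms
  by simp

lemma (in group) int_pow_comm2:
  assumes "g \<in> carrier G" "h \<in> carrier G" "g \<otimes> h = h \<otimes> g"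
  shows "g [^] (i::int) \<otimes> h [^] (j::int) = h [^] j \<otimes> g [^] i"
  using assms int_pow_comm by (metis int_pow_closed)

lemma (in group) commutator_closed [simp]:
  "x \<in> carrier G \<Longrightarrow> z \<in> carrier G \<Longrightarrow> commutator G x z \<in> carrier G"
  by (simp add: commutator_def)

lemma (in group) commutator_eq_iff:
  assumes "x \<in> carrier G" "z \<in> carrier G" "u \<in> carrier G"
  shows "commutator G x z = u \<longleftrightarrow> x \<otimes> z = z \<otimes> x \<otimes> u"
  unfolding commutator_def using assms
  by (metis inv_closed inv_mult_group inv_solve_left m_assoc m_closed)

lemma (in group) commutator_one_iff:
  assumes "x \<in> carrier G" "z \<in> carrier G"
  shows "commutator G x z = \<one> \<longleftrightarrow> x \<otimes> z = z \<otimes> x"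
  using commutator_eq_iff[OF assms one_closed] assms by simp

text \<open>\<open>tri i\<close> is the binomial coefficient \<open>i\<close> over 2, also for negative \<open>i\<close>.\<close>

definition tri :: "int \<Rightarrow> int" where
  "tri i = i * (i - 1) div 2"

lemma two_tri: "2 * tri i = i * (i - 1)"
  by (simp add: tri_def)

lemma tri_add: "tri (i + j) = tri i + tri j + i * j"
proof -
  have "2 * tri (i + j) = 2 * (tri i + tri j + i * j)"
    unfolding distrib_left two_tri by (simp add: algebra_simps)
  then show ?thesis by simp
qed

lemma tri_simps [simp]: "tri 0 = 0" "tri 1 = 0" "tri (-1) = 1"
  by (simp_all add: tri_def)

text \<open>Two elements whose commutator \<open>u\<close> commutes with both, so that they generate
  a group of class at most 2. The value \<open>u = \<one>\<close> is allowed, so the locale can be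
  entered before it is known whether \<open>x\<close> and \<open>z\<close> commute.\<close>

locale heisenberg_triple = group +
  fixes x z u
  assumes x [simp]: "x \<in> carrier G" and z [simp]: "z \<in> carrier G" and u [simp]: "u \<in> carrier G"
    and xz: "x \<otimes> z = z \<otimes> x \<otimes> u" and xu: "x \<otimes> u = u \<otimes> x" and zu: "z \<otimes> u = u \<otimes> z"
begin

lemma x_z_pow: "x \<otimes> z [^] (j::int) = z [^] j \<otimes> x \<otimes> u [^] j"
proof -
  have ziu: "z \<otimes> inv u = inv u \<otimes> z"
    using int_pow_comm[of u z "-1"] zu by (simp add: int_pow_neg)
  have "z \<otimes> x = x \<otimes> (z \<otimes> inv u)"
    by (metis inv_closed inv_solve_right m_assoc m_closed u x xz z)
  then have "inv x \<otimes> z \<otimes> x = z \<otimes> inv u"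
    by (simp add: conj_eq_iff)
  then have "inv x \<otimes> z [^] j \<otimes> x = (z \<otimes> inv u) [^] j"
    using conj_int_pow[of x z j] by simp
  also have "\<dots> = z [^] j \<otimes> inv (u [^] j)"
    by (simp add: int_pow_mult_distrib[OF ziu] int_pow_inv)
  finally have "z [^] j \<otimes> x = x \<otimes> (z [^] j \<otimes> inv (u [^] j))"
    by (simp add: conj_eq_iff)
  then show ?thesis
    by (simp add: m_assoc)
qed

lemma pow_pow: "x [^] (i::int) \<otimes> z [^] (j::int) = z [^] j \<otimes> x [^] i \<otimes> u [^] (i * j)"
proof -
  have "inv (z [^] j) \<otimes> x \<otimes> z [^] j = x \<otimes> u [^] j"
    by (simp add: conj_eq_iff x_z_pow m_assoc)
  then have "inv (z [^] j) \<otimes> x [^] i \<otimes> z [^] j = (x \<otimes> u [^] j) [^] i"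
    using conj_int_pow[of "z [^] j" x i] by simp
  also have "\<dots> = x [^] i \<otimes> u [^] (i * j)"
    using int_pow_mult_distrib[of x "u [^] j" i] int_pow_comm[of u x j] xu
    by (simp add: int_pow_pow mult.commute)
  finally show ?thesis
    by (subst (asm) conj_eq_iff) (simp_all add: m_assoc)
qed

definition W :: "int \<Rightarrow> int \<Rightarrow> int \<Rightarrow> 'a" where
  "W i j k = x [^] i \<otimes> z [^] j \<otimes> u [^] k"

lemma W_closed [simp]: "W i j k \<in> carrier G"
  by (simp add: W_def)

lemma pow_pow': "z [^] (j::int) \<otimes> x [^] (i::int) = x [^] i \<otimes> z [^] j \<otimes> u [^] (- (i * j))"
  by (simp add: pow_pow m_assoc int_pow_mult[symmetric])

lemma W_mult: "W i j k \<otimes> W i' j' k' = W (i + i') (j + j') (k + k' - i' * j)"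
proof -
  have [simp]: "u [^] (k::int) \<otimes> (x [^] (i::int) \<otimes> g) = x [^] i \<otimes> (u [^] k \<otimes> g)"
    "u [^] (k::int) \<otimes> (z [^] (i::int) \<otimes> g) = z [^] i \<otimes> (u [^] k \<otimes> g)"
    "u [^] (k::int) \<otimes> (u [^] (i::int) \<otimes> g) = u [^] (k + i) \<otimes> g"
    "x [^] (k::int) \<otimes> (x [^] (i::int) \<otimes> g) = x [^] (k + i) \<otimes> g"
    "z [^] (k::int) \<otimes> (z [^] (i::int) \<otimes> g) = z [^] (k + i) \<otimes> g"
    if "g \<in> carrier G" for g k i
    using that int_pow_comm2[OF u x xu[symmetric], of k i] int_pow_comm2[OF u z zu[symmetric], of k i]
    by (simp_all add: m_assoc[symmetric] int_pow_mult)
  have "W i j k \<otimes> W i' j' k' = x [^] i \<otimes> ((z [^] j \<otimes> x [^] i') \<otimes> (z [^] j' \<otimes> (u [^] k \<otimes> u [^] k')))"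
    unfolding W_def by (simp add: m_assoc)
  also have "\<dots> = W (i + i') (j + j') (- (i' * j) + (k + k'))"
    unfolding W_def pow_pow' by (simp add: m_assoc int_pow_mult[symmetric])
  finally show ?thesis by (simp add: algebra_simps)
qed

lemma W_0 [simp]: "W 0 0 0 = \<one>"
  by (simp add: W_def)

lemma inv_W: "inv (W i j k) = W (-i) (-j) (-k - i * j)"
  by (rule inv_equality) (simp_all add: W_mult)

lemma W_eqs: "x = W 1 0 0" "z = W 0 1 0" "u = W 0 0 1" "x [^] i = W i 0 0" "z [^] i = W 0 i 0"
    "u [^] i = W 0 0 i"
  by (simp_all add: W_def)

text \<open>The factor number s + 1 moves its \<open>x\<close>-part past s copies of the
  \<open>z\<close>-part and contributes -i * (j * s) to the exponent of \<open>u\<close>; summing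
  over s < r gives the binomial term.\<close>

lemma W_pow: "W i j k [^] (r::int) = W (i * r) (j * r) (k * r - i * j * tri r)"
proof (induction r rule: int_induct[of _ 0])
  case base
  then show ?case by simp
next
  case (step1 r)
  then show ?case
    using tri_add[of r 1] by (simp add: int_pow_mult W_mult algebra_simps)
next
  case (step2 r)
  then show ?case
    using tri_add[of r "-1"] by (simp add: int_pow_diff W_mult inv_W) (simp add: algebra_simps)
qed

text \<open>In class 2 the commutator is bilinear and alternating in the exponents modulo
  \<open>u\<close>, hence a 2 by 2 determinant. The criterion for minimal non-abelian subgroups
  rests on this.\<close>

lemma commutator_W: "commutator G (W i j k) (W i' j' k') = W 0 0 (i * j' - i' * j)"
  by (simp add: commutator_eq_iff W_mult algebra_simps)

lemma generate_subset_W: "generate G {x, z} \<subseteq> {W i j k | i j k. True}"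
proof (rule generate_subgroup_incl)
  show "{x, z} \<subseteq> {W i j k | i j k. True}"
    using W_eqs by blast
  show "subgroup {W i j k | i j k. True} G"
  proof (rule subgroupI)
    show "{W i j k | i j k. True} \<noteq> {}" by blast
  qed (auto simp: inv_W W_mult, blast+)
qed

end

section \<open>Minimal non-abelian subgroups\<close>

lemma (in group) comm_group_subgroup_iff:
  assumes "subgroup H G"
  shows "comm_group (G\<lparr>carrier := H\<rparr>) \<longleftrightarrow> (\<forall>g\<in>H. \<forall>h\<in>H. g \<otimes> h = h \<otimes> g)"
proof -
  interpret H: group "G\<lparr>carrier := H\<rparr>"
    using assms by (rule subgroup_imp_group)
  show ?thesis
    using comm_monoid.m_comm[of "G\<lparr>carrier := H\<rparr>"] H.group_comm_groupI
    by (auto simp: comm_group_def)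
qed

text \<open>A proper subgroup of \<open>H\<close> would be abelian, and the one generated by
  \<open>x\<close> and \<open>z\<close> is not.\<close>

lemma (in group) A1_subgroup_generate:
  assumes "A1_subgroup p H G" "x \<in> H" "z \<in> H" "x \<otimes> z \<noteq> z \<otimes> x"
  shows "generate G {x, z} = H"
proof (rule ccontr)
  assume neq: "generate G {x, z} \<noteq> H"
  from assms have H: "subgroup H G" and A1: "A1_group p (G\<lparr>carrier := H\<rparr>)"
    by (auto simp: A1_subgroup_def)
  have sub: "generate G {x, z} \<subseteq> H" and xz: "{x, z} \<subseteq> carrier G"
    using assms H generate_subgroup_incl[of "{x, z}" H] by (auto dest: subgroup.mem_carrier)
  have gen: "subgroup (generate G {x, z}) G"
    using xz by (rule generate_is_subgroup)
  with sub H have "subgroup (generate G {x, z}) (G\<lparr>carrier := H\<rparr>)"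
    by (simp add: subgroup_incl)
  with A1 neq have "comm_group (G\<lparr>carrier := generate G {x, z}\<rparr>)"
    by (auto simp: A1_group_def)
  then show False
    using assms(4) comm_group_subgroup_iff[OF gen] generate.incl[of _ "{x, z}" G] by blast
qed

lemma (in group) int_pow_cong:
  assumes "g \<in> carrier G" "g [^] N = \<one>" "[i = j] (mod int N)"
  shows "g [^] i = g [^] j"
proof -
  obtain k where "i = j + int N * k"
    using assms(3) by (metis cong_iff_lin cong_sym)
  then show ?thesis
    using assms(1,2) int_pow_pow[of g "int N" k] by (simp add: int_pow_mult int_pow_int)
qed

text \<open>The exponent \<open>d\<close> is invertible modulo the order of the group, a power of p,
  so \<open>v\<close> is itself a power of \<open>v [^] d\<close>. With \<open>M\<close> trivial
  this excludes torsion prime to p.\<close>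

lemma (in group) subgroup_int_pow_cancel:
  assumes p: "Factorial_Ring.prime p" and fin: "finite_p_group p G" and M: "subgroup M G"
    and v: "v \<in> carrier G" "v [^] (d::int) \<in> M" and d: "\<not> int p dvd d"
  shows "v \<in> M"
proof -
  obtain N where N: "order G = p ^ N"
    using fin by (auto simp: finite_p_group_def)
  have "coprime d (int (p ^ N))"
    using p d prime_imp_coprime[of "int p" d] by (simp add: coprime_commute)
  then obtain s where s: "[d * s = 1] (mod int (p ^ N))"
    using cong_solve_coprime_int by blast
  have "(v [^] d) [^] s = v [^] (d * s)"
    using v by (simp add: int_pow_pow)
  also have "\<dots> = v"
    using int_pow_cong[OF v(1) _ s] pow_order_eq_1[OF v(1)] N v by simp
  finally show ?thesis
    using subgroup_int_pow_closed[OF M v(2), of s] by simp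
qed

lemma (in group) card_rcosets_le:
  assumes H: "subgroup H G" and "finite T"
    and cover: "\<And>g. g \<in> carrier G \<Longrightarrow> \<exists>h\<in>H. \<exists>t\<in>T. t \<in> carrier G \<and> g = h \<otimes> t"
  shows "card (rcosets H) \<le> card T"
proof -
  have "rcosets H \<subseteq> (\<lambda>t. H #> t) ` T"
  proof
    fix A assume "A \<in> rcosets H"
    then obtain g where g: "g \<in> carrier G" "A = H #> g"
      by (auto simp: RCOSETS_def)
    then obtain h t where ht: "h \<in> H" "t \<in> T" "t \<in> carrier G" "g = h \<otimes> t"
      using cover by blast
    then have "A = (H #> h) #> t"
      using g coset_mult_assoc[OF subgroup.subset[OF H] subgroup.mem_carrier[OF H ht(1)] ht(3)] by simp
    then have "A = H #> t"
      using coset_join2[OF _ H ht(1)] ht subgroup.mem_carrier[OF H] by simp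
    then show "A \<in> (\<lambda>t. H #> t) ` T"
      using ht by blast
  qed
  then show ?thesis
    using \<open>finite T\<close> by (meson card_image_le card_mono finite_imageI le_trans)
qed

lemma (in group) heisenberg_tripleI:
  assumes "x \<in> carrier G" "z \<in> carrier G" "commutator G x z = u"
    and "x \<otimes> u = u \<otimes> x" "z \<otimes> u = u \<otimes> z"
  shows "heisenberg_triple G x z u"
  using assms commutator_closed[of x z] commutator_eq_iff[of x z u] by unfold_locales auto

context heisenberg_triple
begin

text \<open>If \<open>[x, z] \<noteq> 1\<close> then \<open>H = \<langle>x, z\<rangle>\<close> with \<open>z = [x, t]\<close>, so \<open>t\<close> is a power of \<open>x\<close> times an
  element of \<open>\<langle>z, u\<rangle>\<close>, and \<open>[x, t]\<close> already lies in \<open>\<langle>u\<rangle>\<close>.\<close>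

lemma A1_subgroup_trivial_commutator:
  assumes A1: "A1_subgroup p H G" and "x \<in> H" "t \<in> H" "z = commutator G x t"
  shows "u = \<one>"
proof (rule ccontr)
  assume u1: "u \<noteq> \<one>"
  have H: "subgroup H G"
    using A1 by (simp add: A1_subgroup_def)
  note [simp] = subgroup.mem_carrier[OF H]
  have "z \<in> H"
    using assms H by (simp add: commutator_def subgroup.m_closed subgroup.m_inv_closed)
  moreover have "x \<otimes> z \<noteq> z \<otimes> x"
    using u1 xz r_cancel_one'[of "z \<otimes> x" u] by auto
  ultimately have "generate G {x, z} = H"
    by (rule A1_subgroup_generate[OF A1 \<open>x \<in> H\<close>])
  then obtain i j k where t: "t = W i j k"
    using subsetD[OF generate_subset_W] \<open>t \<in> H\<close> by blast
  have "z = W 0 0 j"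
    using assms(4) commutator_W[of 1 0 0 i j k] W_eqs(1) t by simp
  then have "x \<otimes> z = z \<otimes> x"
    using int_pow_comm[OF u x xu[symmetric], of j] by (simp add: W_def)
  with \<open>x \<otimes> z \<noteq> z \<otimes> x\<close> show False ..
qed

text \<open>Division of the exponents of \<open>x\<close> and \<open>z\<close> by M and N leaves
  remainders below M and N; the quotient parts, and all powers of \<open>u\<close>, are absorbed
  into the central subgroup \<open>L\<close>. The choices made later for \<open>L\<close> are
  \<open>K\<close> and \<open>K_line t\<close>.\<close>

lemma card_generate_le:
  fixes M N :: nat
  assumes L: "subgroup L G" "finite L" "\<And>g l. g \<in> carrier G \<Longrightarrow> l \<in> L \<Longrightarrow> g \<otimes> l = l \<otimes> g"
    and "u \<in> L" "x [^] M \<in> L" "z [^] N \<in> L" and MN: "M > 0" "N > 0"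
  shows "card (generate G {x, z}) \<le> M * N * card L"
proof -
  let ?f = "\<lambda>(i, j, l). x [^] (i::nat) \<otimes> z [^] (j::nat) \<otimes> l"
  let ?D = "{..<M} \<times> {..<N} \<times> L"
  note [simp] = subgroup.mem_carrier[OF L(1)]
  have Lpow: "l [^] (i::int) \<in> L" if "l \<in> L" for l i
    using L(1) that by (rule subgroup_int_pow_closed)
  have red: "\<exists>r<M. \<exists>l\<in>L. g [^] i = g [^] r \<otimes> l"
    if g: "g \<in> carrier G" "g [^] M \<in> L" "M > 0" for g and M :: nat and i :: int
  proof (intro exI bexI conjI)
    show "nat (i mod int M) < M"
      using \<open>M > 0\<close> by (simp add: nat_less_iff)
    show "(g [^] M) [^] (i div int M) \<in> L"
      using g Lpow by blast
    have "g [^] i = g [^] (i mod int M + int M * (i div int M))"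
      by simp
    also have "\<dots> = g [^] (i mod int M) \<otimes> (g [^] int M) [^] (i div int M)"
      using g by (subst int_pow_mult) (simp_all add: int_pow_pow)
    also have "\<dots> = g [^] nat (i mod int M) \<otimes> (g [^] M) [^] (i div int M)"
      using \<open>M > 0\<close> by (simp add: int_pow_int[symmetric] del: int_pow_int)
    finally show "g [^] i = \<dots>" .
  qed
  have "generate G {x, z} \<subseteq> ?f ` ?D"
  proof
    fix g assume "g \<in> generate G {x, z}"
    then obtain i j k where g: "g = x [^] (i::int) \<otimes> z [^] (j::int) \<otimes> u [^] (k::int)"
      using generate_subset_W unfolding W_def by blast
    from red[OF x assms(5) MN(1), of i] obtain r l
      where r: "r < M" "l \<in> L" "x [^] i = x [^] r \<otimes> l" by blast
    from red[OF z assms(6) MN(2), of j] obtain s l'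
      where s: "s < N" "l' \<in> L" "z [^] j = z [^] s \<otimes> l'" by blast
    have "l \<otimes> (z [^] s \<otimes> (l' \<otimes> u [^] k)) = z [^] s \<otimes> l \<otimes> (l' \<otimes> u [^] k)"
      using r s L(3)[of "z [^] s" l] by (simp add: m_assoc[symmetric])
    then have "g = x [^] r \<otimes> z [^] s \<otimes> (l \<otimes> (l' \<otimes> u [^] k))"
      using r s by (simp add: g m_assoc)
    moreover have "l \<otimes> (l' \<otimes> u [^] k) \<in> L"
      using r s L(1) Lpow[OF \<open>u \<in> L\<close>] by (simp add: subgroup.m_closed)
    ultimately show "g \<in> ?f ` ?D"
      using r s by force
  qed
  then have "card (generate G {x, z}) \<le> card ?D"
    using L(2) by (meson card_image_le card_mono finite_SigmaI finite_imageI finite_lessThan le_trans)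
  then show ?thesis by (simp add: card_cartesian_product)
qed

text \<open>A non-abelian subgroup \<open>M\<close> contains a pair whose exponent matrix has
  determinant prime to p, because the commutator of the pair is a nontrivial power of
  \<open>u\<close>. Inverting that matrix recovers \<open>u\<close>, \<open>x\<close> and
  \<open>z\<close> inside \<open>M\<close>, so \<open>M\<close> is everything.\<close>

lemma A1_subgroup_generateI:
  assumes p: "Factorial_Ring.prime p" and fin: "finite_p_group p G"
    and u1: "u \<noteq> \<one>" and up: "u [^] p = \<one>"
  shows "A1_subgroup p (generate G {x, z}) G"
proof -
  let ?H = "generate G {x, z}"
  have H: "subgroup ?H G"
    by (rule generate_is_subgroup) simp
  have xH: "x \<in> ?H" and zH: "z \<in> ?H"
    by (auto intro: generate.incl)
  obtain N where fc: "finite (carrier G)" and N: "order G = p ^ N"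
    using fin by (auto simp: finite_p_group_def)
  have "card ?H dvd p ^ N"
    using lagrange[OF H] N by (metis dvd_triv_right)
  then have "\<exists>k. card ?H = p ^ k"
    using divides_primepow_nat[OF p] by blast
  moreover have "finite ?H"
    using subgroup.subset[OF H] fc by (rule finite_subset)
  ultimately have "finite_p_group p (G\<lparr>carrier := ?H\<rparr>)"
    using subgroup_imp_group[OF H] by (simp add: finite_p_group_def order_def)
  moreover have "\<not> comm_group (G\<lparr>carrier := ?H\<rparr>)"
  proof -
    have "x \<otimes> z \<noteq> z \<otimes> x"
      using u1 xz r_cancel_one'[of "z \<otimes> x" u] by auto
    then show ?thesis
      using comm_group_subgroup_iff[OF H] xH zH by blast
  qed
  moreover have "comm_group (G\<lparr>carrier := M\<rparr>)"
    if M': "subgroup M (G\<lparr>carrier := ?H\<rparr>)" and ne: "M \<noteq> ?H" for M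
  proof (rule ccontr)
    assume nc: "\<not> comm_group (G\<lparr>carrier := M\<rparr>)"
    have M: "subgroup M G" and MH: "M \<subseteq> ?H"
      using M' H incl_subgroup subgroup.subset by fastforce+
    obtain g h where gh: "g \<in> M" "h \<in> M" "g \<otimes> h \<noteq> h \<otimes> g"
      using nc comm_group_subgroup_iff[OF M] by blast
    obtain i j k i' j' k' where g: "g = W i j k" and h: "h = W i' j' k'"
      using subsetD[OF generate_subset_W subsetD[OF MH gh(1)]]
        subsetD[OF generate_subset_W subsetD[OF MH gh(2)]] by blast
    define d where "d = i * j' - i' * j"
    note Mpow = subgroup_int_pow_closed[OF M]
    have ud: "u [^] d = commutator G g h"
      unfolding g h commutator_W d_def by (simp add: W_def)
    then have udM: "u [^] d \<in> M"
      using gh M by (simp add: commutator_def subgroup.m_closed subgroup.m_inv_closed)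
    have "u [^] d \<noteq> \<one>"
      using gh commutator_one_iff[of g h] ud g h by simp
    then have pd: "\<not> int p dvd d"
      using int_pow_cong[OF u up, of d 0] by (auto simp: cong_0_iff)
    note unpow = subgroup_int_pow_cancel[OF p fin M _ _ pd]
    have uM: "u \<in> M"
      using udM unpow by simp
    have clear: "w \<in> M" if "w \<otimes> u [^] (c::int) \<in> M" "w \<in> carrier G" for w c
      using that subgroup.m_closed[OF M that(1) Mpow[OF uM, of "-c"]]
      by (simp add: int_pow_neg m_assoc)
    \<comment> \<open>Cramer's rule: these products have exponent vectors (d, 0) and (0, d) in
      \<open>x\<close> and \<open>z\<close>, up to a power of \<open>u\<close>, which is already
      known to lie in \<open>M\<close>.\<close>
    have "g [^] j' \<otimes> h [^] (-j) \<in> M" "h [^] i \<otimes> g [^] (-i') \<in> M"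
      using Mpow gh M by (simp_all add: subgroup.m_closed)
    then have "\<exists>c. W d 0 c \<in> M" "\<exists>c. W 0 d c \<in> M"
      unfolding g h W_pow W_mult d_def by (auto simp: algebra_simps)
    then have "x [^] d \<in> M" "z [^] d \<in> M"
      using clear by (auto simp: W_def)
    then have "x \<in> M" "z \<in> M"
      using unpow by auto
    then have "?H \<subseteq> M"
      using M by (simp add: generate_subgroup_incl)
    with MH ne show False by blast
  qed
  ultimately show ?thesis
    using H by (auto simp: A1_subgroup_def A1_group_def)
qed

end

section \<open>Multiplication in normal form\<close>

lemma tri_minus: "tri (- i) = i * i - tri i"
  using tri_add[of i "-i"] by simp

text \<open>The binomial coefficient r over 3; summing \<open>tri\<close> once more is what taking
  powers in class 3 produces.\<close>

definition tet :: "nat \<Rightarrow> int" where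
  "tet r = (\<Sum>s<r. tri (int s))"

lemma six_tet: "6 * tet r = int r * (int r - 1) * (int r - 2)"
proof (induction r)
  case 0
  then show ?case by (simp add: tet_def)
next
  case (Suc r)
  have "6 * tet (Suc r) = 6 * tet r + 3 * (2 * tri (int r))"
    by (simp add: tet_def)
  also have "\<dots> = int (Suc r) * (int (Suc r) - 1) * (int (Suc r) - 2)"
    unfolding Suc.IH two_tri by (simp add: algebra_simps)
  finally show ?case .
qed

lemma tet_simps [simp]: "tet 0 = 0" "tet (Suc r) = tet r + tri (int r)"
  by (simp_all add: tet_def)

text \<open>The structure into which the hypotheses are unwound at the end of the development. The
  inequality \<open>order_ge\<close> serves the lower bounds on indices; upper bounds come from
  explicit coset covers built on \<open>span\<close>. The integers w11, ..., w22 represent the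
  entries of the characteristic matrix.\<close>

locale metabelian_tower = group +
  fixes p n m :: nat and a b c y and w11 w12 w21 w22 :: int
  assumes p: "Factorial_Ring.prime p" and odd_p: "odd p" and p_group: "finite_p_group p G"
    and order_ge: "p ^ (n + m + 3) \<le> order G" and m_less_n: "m < n"
    and a [simp]: "a \<in> carrier G" and b [simp]: "b \<in> carrier G"
    and c [simp]: "c \<in> carrier G" and y [simp]: "y \<in> carrier G"
    and ab: "a \<otimes> b = b \<otimes> a \<otimes> c" and ac: "a \<otimes> c = c \<otimes> a \<otimes> y" and bc: "b \<otimes> c = c \<otimes> b"
    and ay: "a \<otimes> y = y \<otimes> a" and b_y: "b \<otimes> y = y \<otimes> b" and cy: "c \<otimes> y = y \<otimes> c"
    and span: "g \<in> carrier G \<Longrightarrow>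
      \<exists>(i::int) (j::int) (k::int) (l::int). g = a [^] i \<otimes> b [^] j \<otimes> c [^] k \<otimes> y [^] l"
    and c_pow: "c [^] (p ^ 2) = \<one>" and y_pow: "y [^] p = \<one>"
    and indep: "c [^] (int p * i) \<otimes> y [^] (j::int) = \<one> \<Longrightarrow> int p dvd i \<and> int p dvd j"
    and a_pow: "a [^] (p ^ n) = c [^] (w11 * int p) \<otimes> y [^] w12"
    and b_pow: "b [^] (p ^ m) = c [^] (w21 * int p) \<otimes> y [^] w22"
begin

definition P :: "int \<Rightarrow> int \<Rightarrow> int \<Rightarrow> int \<Rightarrow> 'a" where
  "P i j k l = a [^] i \<otimes> b [^] j \<otimes> c [^] k \<otimes> y [^] l"

lemma P_closed [simp]: "P i j k l \<in> carrier G"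
  by (simp add: P_def)

lemma P_cases: "g \<in> carrier G \<Longrightarrow> \<exists>i j k l. g = P i j k l"
  using span by (simp add: P_def)

sublocale acy: heisenberg_triple G a c y
  by unfold_locales (simp_all add: ac ay cy)

text \<open>Conjugation by \<open>b\<close> sends \<open>a\<close> to \<open>a \<otimes> c\<close>,
  and the i-th power of the latter is known inside the class 2 group of \<open>a\<close> and
  \<open>c\<close>. Read backwards, this conjugates \<open>b\<close> by \<open>a [^] i\<close>;
  passing to \<open>b [^] j\<close> is then free because \<open>b\<close>, \<open>c\<close> and
  \<open>y\<close> commute.\<close>

lemma pow_b_a: "b [^] j \<otimes> a [^] i = a [^] i \<otimes> b [^] (j::int) \<otimes> c [^] (- (i * j)) \<otimes> y [^] (j * tri i)"
proof -
  have bcy: "b \<otimes> (c [^] (i::int) \<otimes> y [^] (l::int)) = (c [^] i \<otimes> y [^] l) \<otimes> b" for i l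
    using int_pow_comm[of c b i] int_pow_comm[of y b l] bc b_y
    by (metis b c y int_pow_closed m_assoc)
  have "inv b \<otimes> a \<otimes> b = a \<otimes> c"
    by (subst conj_eq_iff) (simp_all add: ab m_assoc)
  then have "inv b \<otimes> a [^] i \<otimes> b = (a \<otimes> c) [^] i"
    using conj_int_pow[of b a i] by simp
  also have "\<dots> = a [^] i \<otimes> c [^] i \<otimes> y [^] (- tri i)"
    using acy.W_pow[of 1 1 0 i] by (simp add: acy.W_def)
  finally have "a [^] i \<otimes> b = b \<otimes> (a [^] i \<otimes> c [^] i \<otimes> y [^] (- tri i))"
    by (subst (asm) conj_eq_iff) simp_all
  then have "a [^] i \<otimes> b \<otimes> (y [^] tri i \<otimes> c [^] (-i)) = b \<otimes> a [^] i"
    by (simp add: m_assoc int_pow_neg)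
  moreover have "y [^] tri i \<otimes> c [^] (-i) = c [^] (-i) \<otimes> y [^] tri i"
    by (rule int_pow_comm2) (simp_all add: cy)
  ultimately have "b \<otimes> a [^] i = a [^] i \<otimes> (b \<otimes> (c [^] (-i) \<otimes> y [^] tri i))"
    by (simp add: m_assoc)
  then have "inv (a [^] i) \<otimes> b \<otimes> a [^] i = b \<otimes> (c [^] (-i) \<otimes> y [^] tri i)"
    by (simp add: conj_eq_iff)
  then have "inv (a [^] i) \<otimes> b [^] j \<otimes> a [^] i = (b \<otimes> (c [^] (-i) \<otimes> y [^] tri i)) [^] j"
    using conj_int_pow[of "a [^] i" b j] by simp
  also have "\<dots> = b [^] j \<otimes> (c [^] (-i) \<otimes> y [^] tri i) [^] j"
    by (rule int_pow_mult_distrib[OF bcy]) simp_all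
  also have "(c [^] (-i) \<otimes> y [^] tri i) [^] j = c [^] (-(i * j)) \<otimes> y [^] (j * tri i)"
    using int_pow_mult_distrib[OF int_pow_comm2[OF c y cy], of "-i" "tri i" j]
    by (simp add: int_pow_pow mult.commute)
  finally show ?thesis
    by (subst (asm) conj_eq_iff) (simp_all add: m_assoc)
qed

text \<open>Moving \<open>a [^] i'\<close> to the left past \<open>c [^] k\<close> costs -i' * k in
  \<open>y\<close>; moving it past \<open>b [^] j\<close> costs -i' * j in \<open>c\<close> and j *
  tri i' in \<open>y\<close>.\<close>

lemma P_mult: "P i j k l \<otimes> P i' j' k' l' =
  P (i + i') (j + j') (k + k' - i' * j) (l + l' - i' * k + j * tri i')"
proof -
  have mv: "u [^] (k::int) \<otimes> (v [^] (i::int) \<otimes> g) = v [^] i \<otimes> (u [^] k \<otimes> g)"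
    if "g \<in> carrier G" "u \<in> carrier G" "v \<in> carrier G" "u \<otimes> v = v \<otimes> u" for u v g k i
    using that int_pow_comm2[of u v k i] by (simp add: m_assoc[symmetric])
  have mg: "u [^] (k::int) \<otimes> (u [^] (i::int) \<otimes> g) = u [^] (k + i) \<otimes> g"
    if "g \<in> carrier G" "u \<in> carrier G" for u g k i
    using that by (simp add: m_assoc[symmetric] int_pow_mult)
  note rules = mv[OF _ y a ay[symmetric]] mv[OF _ y b b_y[symmetric]] mv[OF _ y c cy[symmetric]]
    mv[OF _ c b bc[symmetric]] mg
  have "P i j k l \<otimes> P i' j' k' l' = a [^] i \<otimes> (b [^] j \<otimes>
      ((c [^] k \<otimes> a [^] i') \<otimes> (b [^] j' \<otimes> (c [^] k' \<otimes> (y [^] l \<otimes> y [^] l')))))"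
    unfolding P_def by (simp add: m_assoc rules)
  also have "\<dots> = a [^] i \<otimes> ((b [^] j \<otimes> a [^] i') \<otimes>
      (b [^] j' \<otimes> (c [^] (k + k') \<otimes> (y [^] (- (i' * k)) \<otimes> (y [^] l \<otimes> y [^] l')))))"
    unfolding acy.pow_pow' by (simp add: m_assoc rules)
  also have "\<dots> = P (i + i') (j + j') (- (i' * j) + (k + k')) (j * tri i' + (- (i' * k) + (l + l')))"
    unfolding pow_b_a P_def by (simp add: m_assoc rules int_pow_mult[symmetric])
  finally show ?thesis by (simp add: algebra_simps)
qed

lemma P_0 [simp]: "P 0 0 0 0 = \<one>"
  by (simp add: P_def)

lemma inv_P: "inv (P i j k l) = P (-i) (-j) (- k - i * j) (- l - i * k - j * tri (-i))"
  by (rule inv_equality) (simp_all add: P_mult tri_minus algebra_simps)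

text \<open>The corrections of \<open>P_mult\<close> are summed over the r factors. The correction
  in \<open>c\<close> is already quadratic and feeds into \<open>y\<close> once more, whence the
  cubic term \<open>tet r\<close>.\<close>

lemma P_pow: "P i j k l [^] (r::nat) =
  P (i * int r) (j * int r) (k * int r - i * j * tri (int r))
    (l * int r - i * k * tri (int r) + i * i * j * tet r + j * tri i * tri (int r))"
proof (induction r)
  case 0
  then show ?case by simp
next
  case (Suc r)
  have "tri (1 + int r) = tri (int r) + int r"
    using tri_add[of 1 "int r"] by simp
  with Suc show ?case
    by (simp add: P_mult) (simp add: algebra_simps)
qed

lemma P_int_pow: "\<exists>j' k' l'. P i j k l [^] (r::int) = P (i * r) j' k' l'"
proof (cases r rule: int_cases2)
  case (nonneg s)
  then show ?thesis by (auto simp: P_pow int_pow_int)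
next
  case (nonpos s)
  then have "P i j k l [^] r = inv (P i j k l [^] s)"
    by (simp add: int_pow_neg int_pow_int)
  then show ?thesis
    using nonpos by (auto simp: P_pow inv_P)
qed

lemma P_pow_abelian: "P 0 j k l [^] (r::int) = P 0 (j * r) (k * r) (l * r)"
proof (cases r rule: int_cases2)
  case (nonneg s)
  then show ?thesis by (simp add: P_pow int_pow_int)
next
  case (nonpos s)
  then show ?thesis
    by (simp add: P_pow inv_P int_pow_neg int_pow_int)
qed

lemma P_eqI:
  assumes "[k = k'] (mod (int p)^2)" "[l = l'] (mod int p)"
  shows "P i j k l = P i j k' l'"
proof -
  have "c [^] k = c [^] k'" "y [^] l = y [^] l'"
    using assms by (auto intro: int_pow_cong c_pow y_pow)
  then show ?thesis by (simp add: P_def)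
qed

lemma p_gt_1: "int p > 1"
  using p prime_gt_1_nat by auto

lemma P_eq_one_iff: "P 0 0 k l = \<one> \<longleftrightarrow> int p ^ 2 dvd k \<and> int p dvd l"
proof
  assume one: "P 0 0 k l = \<one>"
  \<comment> \<open>\<open>indep\<close> speaks only of exponents of \<open>c\<close> divisible by
    p, so the p-th power is taken first: it shows that p divides k, after which \<open>indep\<close>
    applies to the element itself.\<close>
  have "P 0 0 k l [^] p = P 0 0 (int p * k) 0"
    unfolding P_pow by (simp, rule P_eqI) (simp_all add: cong_0_iff mult.commute)
  with one have "c [^] (int p * k) \<otimes> y [^] (0::int) = \<one>"
    by (simp add: P_def)
  then obtain k' where k: "k = int p * k'"
    using indep by blast
  from one have "c [^] (int p * k') \<otimes> y [^] l = \<one>"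
    by (simp add: P_def k)
  from indep[OF this] show "int p ^ 2 dvd k \<and> int p dvd l"
    by (simp add: k power2_eq_square)
next
  assume "int p ^ 2 dvd k \<and> int p dvd l"
  then have "P 0 0 k l = P 0 0 0 0"
    by (intro P_eqI) (simp_all add: cong_0_iff)
  then show "P 0 0 k l = \<one>" by simp
qed

text \<open>The subgroup of all \<open>P 0 j k l\<close> is abelian and normal, so only the exponent
  of \<open>a\<close> in the first argument can matter.\<close>

lemma commutator_P: "commutator G (P i j' k' l') (P 0 j k l) = P 0 0 (i * j) (i * k - j * tri i)"
  by (simp add: commutator_eq_iff P_mult) (simp add: algebra_simps)

lemma P_commute_iff: "P i j' k' l' \<otimes> P 0 j k l = P 0 j k l \<otimes> P i j' k' l' \<longleftrightarrow>
  int p ^ 2 dvd i * j \<and> int p dvd i * k - j * tri i"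
  using commutator_one_iff[of "P i j' k' l'" "P 0 j k l"] by (simp add: commutator_P P_eq_one_iff)

lemma P_a_pow: "P (int p ^ n * i) 0 0 0 = P 0 0 (int p * (w11 * i)) (w12 * i)"
proof -
  have "P (int p ^ n * i) 0 0 0 = a [^] (int (p ^ n) * i)"
    by (simp add: P_def)
  also have "\<dots> = (a [^] (p ^ n)) [^] i"
    using int_pow_pow[of a "int (p ^ n)" i] by (simp only: a int_pow_int simp_thms)
  also have "a [^] (p ^ n) = P 0 0 (w11 * int p) w12"
    by (simp add: a_pow P_def)
  finally show ?thesis
    by (simp add: P_pow_abelian algebra_simps)
qed

lemma P_b_pow: "P 0 (int p ^ m * i) 0 0 = P 0 0 (int p * (w21 * i)) (w22 * i)"
proof -
  have "P 0 (int p ^ m * i) 0 0 = b [^] (int (p ^ m) * i)"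
    by (simp add: P_def)
  also have "\<dots> = (b [^] (p ^ m)) [^] i"
    using int_pow_pow[of b "int (p ^ m)" i] by (simp only: b int_pow_int simp_thms)
  also have "b [^] (p ^ m) = P 0 0 (w21 * int p) w22"
    by (simp add: b_pow P_def)
  finally show ?thesis
    by (simp add: P_pow_abelian algebra_simps)
qed

text \<open>The element \<open>b [^] (p ^ m)\<close> lies in the central subgroup spanned by
  \<open>c [^] p\<close> and \<open>y\<close>, yet its commutator with \<open>a\<close> is
  \<open>c [^] (p ^ m)\<close>. As \<open>c\<close> has order p^2, this forces p^2 to divide
  p^m.\<close>

lemma m_ge_2: "m \<ge> 2"
proof -
  have "P 1 0 0 0 \<otimes> P 0 (int p ^ m) 0 0 = P 0 (int p ^ m) 0 0 \<otimes> P 1 0 0 0"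
    using P_b_pow[of 1] by (simp add: P_commute_iff)
  then have "int p ^ 2 dvd int p ^ m"
    by (simp add: P_commute_iff)
  then have "int p ^ 2 \<le> int p ^ m"
    by (rule zdvd_imp_le) (use p_gt_1 in simp)
  then show ?thesis
    using p_gt_1 by (rule power_le_imp_le_exp[rotated])
qed

end

section \<open>Generators and orders of minimal non-abelian subgroups\<close>

lemma dvd_tri:
  assumes "odd d" "d dvd i"
  shows "d dvd tri i"
proof -
  have "d dvd 2 * tri i"
    using assms(2) by (simp add: two_tri)
  then show ?thesis
    using assms(1) coprime_dvd_mult_right_iff[of d 2 "tri i"] by simp
qed

text \<open>For p = 3 the denominator 6 swallows one factor p; this is why p^2, and not just p, is
  assumed to divide r.\<close>

lemma prime_dvd_tet:
  assumes p: "Factorial_Ring.prime p" "odd p" and "p ^ 2 dvd r"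
  shows "int p dvd tet r"
proof -
  have "int p ^ 2 dvd 6 * tet r"
    using assms(3) unfolding six_tet by (metis dvd_mult2 int_dvd_int_iff of_nat_power)
  then have "int p ^ 2 dvd 2 * (3 * tet r)" by simp
  moreover have "coprime (int p ^ 2) 2"
    using p(2) by simp
  ultimately have 3: "int p ^ 2 dvd 3 * tet r"
    using coprime_dvd_mult_right_iff by blast
  show ?thesis
  proof (cases "p = 3")
    case True
    with 3 have "9 dvd 3 * tet r" by simp
    then show ?thesis unfolding True by presburger
  next
    case False
    then have "coprime (int p) 3"
      using p(1) primes_coprime[of "int p" 3] by simp
    moreover have "int p dvd 3 * tet r"
      by (rule dvd_trans[OF _ 3]) (simp add: power2_eq_square)
    ultimately show ?thesis
      using coprime_dvd_mult_right_iff by blast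
  qed
qed

section \<open>The central plane \<open>K\<close>, its lines, and p-power maps\<close>

context metabelian_tower
begin

lemma P_central: "g \<in> carrier G \<Longrightarrow> g \<otimes> P 0 0 (int p * k) l = P 0 0 (int p * k) l \<otimes> g"
  using P_cases[of g] by (auto simp: P_commute_iff)

definition K :: "'a set" where
  "K = {P 0 0 (int p * k) l | k l. True}"

text \<open>The subgroup generated by \<open>c [^] p \<otimes> y [^] t\<close>: viewing
  \<open>K\<close> as a plane over the field with p elements, the line through (1, t).\<close>

definition K_line :: "int \<Rightarrow> 'a set" where
  "K_line t = {P 0 0 (int p * k) (t * k) | k. True}"

lemma K_I [intro]: "int p dvd k \<Longrightarrow> P 0 0 k l \<in> K"
  by (auto simp: K_def dvd_def)

lemma subgroup_K: "subgroup K G"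
proof (rule subgroupI)
  show "K \<noteq> {}" by (auto simp: K_def)
next
  fix g assume "g \<in> K"
  then show "inv g \<in> K" by (auto simp: K_def inv_P) (metis mult_minus_right)
next
  fix g h assume "g \<in> K" "h \<in> K"
  then show "g \<otimes> h \<in> K" by (auto simp: K_def P_mult) (metis distrib_left)
qed (auto simp: K_def)

lemma subgroup_K_line: "subgroup (K_line t) G"
proof (rule subgroupI)
  show "K_line t \<noteq> {}" by (auto simp: K_line_def)
next
  fix g assume "g \<in> K_line t"
  then show "inv g \<in> K_line t" by (auto simp: K_line_def inv_P) (metis mult_minus_right)
next
  fix g h assume "g \<in> K_line t" "h \<in> K_line t"
  then show "g \<otimes> h \<in> K_line t" by (auto simp: K_line_def P_mult) (metis distrib_left)
qed (auto simp: K_line_def)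

lemma P_K_mod: "P 0 0 (int p * k) l = P 0 0 (int p * (k mod int p)) (l mod int p)"
proof (rule P_eqI)
  have "int p * k = int p * (k mod int p + int p * (k div int p))"
    by (simp only: mod_mult_div_eq)
  also have "\<dots> = int p * (k mod int p) + (int p)^2 * (k div int p)"
    by (simp only: distrib_left power2_eq_square mult.assoc)
  finally show "[int p * k = int p * (k mod int p)] (mod (int p)^2)"
    by (simp only: cong_def mod_mult_self2)
qed (simp add: cong_def)

lemma card_K: "finite K" "card K \<le> p ^ 2"
proof -
  let ?D = "{0..<int p} \<times> {0..<int p}"
  have sub: "K \<subseteq> (\<lambda>(k, l). P 0 0 (int p * k) l) ` ?D"
  proof
    fix g assume "g \<in> K"
    then obtain k l where "g = P 0 0 (int p * k) l" by (auto simp: K_def)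
    with P_K_mod[of k l] have "g = (\<lambda>(k, l). P 0 0 (int p * k) l) (k mod int p, l mod int p)"
      by simp
    moreover have "(k mod int p, l mod int p) \<in> ?D"
      using p_gt_1 by simp
    ultimately show "g \<in> (\<lambda>(k, l). P 0 0 (int p * k) l) ` ?D" by blast
  qed
  then show "finite K" by (rule finite_subset) simp
  have "card K \<le> card ?D"
    using sub by (meson card_image_le card_mono finite_SigmaI finite_atLeastLessThan_int finite_imageI le_trans)
  then show "card K \<le> p ^ 2" by (simp add: power2_eq_square)
qed

lemma card_K_line: "finite (K_line t)" "card (K_line t) \<le> p"
proof -
  have sub: "K_line t \<subseteq> (\<lambda>k. P 0 0 (int p * k) (t * k)) ` {0..<int p}"
  proof
    fix g assume "g \<in> K_line t"
    then obtain k where "g = P 0 0 (int p * k) (t * k)" by (auto simp: K_line_def)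
    moreover have "P 0 0 (int p * k) (t * k) = P 0 0 (int p * (k mod int p)) (t * (k mod int p))"
      unfolding P_K_mod[of k] P_K_mod[of "k mod int p"] by (simp add: mod_mult_right_eq)
    moreover have "k mod int p \<in> {0..<int p}"
      using p_gt_1 by simp
    ultimately show "g \<in> (\<lambda>k. P 0 0 (int p * k) (t * k)) ` {0..<int p}" by blast
  qed
  then show "finite (K_line t)" by (rule finite_subset) simp
  have "card (K_line t) \<le> card {0..<int p}"
    using sub by (meson card_image_le card_mono finite_atLeastLessThan_int finite_imageI le_trans)
  then show "card (K_line t) \<le> p" by simp
qed

lemma K_central: "g \<in> carrier G \<Longrightarrow> l \<in> K \<Longrightarrow> g \<otimes> l = l \<otimes> g"
  by (auto simp: K_def P_central)

lemma K_line_subset: "K_line t \<subseteq> K"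
  by (auto simp: K_def K_line_def)

text \<open>For r at least 2 the binomial corrections in \<open>c\<close> are divisible by p^2 and
  those in \<open>y\<close> by p, so they vanish together with the powers of \<open>c\<close> and
  \<open>y\<close>.\<close>

lemma P_pow_p_power:
  assumes "r \<ge> 2"
  shows "P i j k l [^] (p ^ r) = P (i * int p ^ r) 0 0 0 \<otimes> P 0 (j * int p ^ r) 0 0"
proof -
  have "int p ^ 2 dvd int p ^ r"
    using assms by (simp add: le_imp_power_dvd)
  then have T: "int p ^ 2 dvd tri (int p ^ r)"
    using dvd_tri[of "int p ^ 2" "int p ^ r"] odd_p by simp
  have "int p dvd int p ^ r"
    using assms by (simp add: dvd_power)
  moreover from this have "int p dvd tri (int p ^ r)"
    using dvd_tri odd_p by simp
  moreover have "int p dvd tet (p ^ r)"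
    by (rule prime_dvd_tet) (use assms p odd_p in \<open>simp_all add: le_imp_power_dvd\<close>)
  ultimately show ?thesis
    using T \<open>int p ^ 2 dvd int p ^ r\<close>
    unfolding P_pow P_mult by (auto intro!: P_eqI simp: cong_0_iff)
qed

lemma P_b_pow_large:
  assumes "r > m"
  shows "P 0 (j * int p ^ r) 0 0 = \<one>"
proof -
  obtain s where "r = Suc (m + s)"
    using less_imp_Suc_add[OF assms] by blast
  then have "P 0 (j * int p ^ r) 0 0 = P 0 (int p ^ m * (int p * (int p ^ s * j))) 0 0"
    by (simp add: power_add mult_ac)
  also have "\<dots> = \<one>"
    unfolding P_b_pow P_eq_one_iff by (simp add: power2_eq_square)
  finally show ?thesis .
qed

lemma P_pow_p_n: "P i j k l [^] (p ^ n) = P 0 0 (int p * (w11 * i)) (w12 * i)"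
  using P_a_pow[of i] P_b_pow_large[OF m_less_n, of j] m_ge_2 m_less_n
  by (simp add: P_pow_p_power mult.commute)

lemma P_pow_p_m: "P 0 j k l [^] (p ^ m) = P 0 0 (int p * (w21 * j)) (w22 * j)"
  using P_b_pow[of j] m_ge_2 by (simp add: P_pow_p_power mult.commute)

text \<open>When p divides the exponent of \<open>a\<close>, the power p^(n-1) already lands in
  \<open>K\<close>. The \<open>b\<close>-part has to be kept: for n - 1 = m it need not be
  trivial.\<close>

lemma P_pow_p_n': "P (int p * i) j k l [^] (p ^ (n - 1)) =
    P 0 0 (int p * (w11 * i)) (w12 * i) \<otimes>
    P 0 0 (int p * (w21 * (int p ^ (n - 1 - m) * j))) (w22 * (int p ^ (n - 1 - m) * j))"
proof -
  have "int p ^ n = int p * int p ^ (n - 1)"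
    using m_less_n by (simp flip: power_Suc)
  then have "int p * i * int p ^ (n - 1) = int p ^ n * i"
    by simp
  moreover have "int p ^ (n - 1) = int p ^ m * int p ^ (n - 1 - m)"
    using m_less_n by (simp flip: power_add)
  then have "j * int p ^ (n - 1) = int p ^ m * (int p ^ (n - 1 - m) * j)"
    by simp
  moreover have "n - 1 \<ge> 2"
    using m_ge_2 m_less_n by simp
  ultimately show ?thesis
    by (simp only: P_pow_p_power P_a_pow P_b_pow)
qed

lemma heisenberg_triple_P:
  assumes "int p dvd i * j"
  shows "heisenberg_triple G (P i j' k' l') (P 0 j k l) (P 0 0 (i * j) (i * k - j * tri i))"
proof -
  obtain d where d: "i * j = int p * d" using assms by blast
  show ?thesis
    by (rule heisenberg_tripleI) (simp_all add: commutator_P P_central d)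
qed

text \<open>Euclid's algorithm on the exponents of \<open>a\<close> in a pair of non-commuting elements.\<close>

lemma A1_subgroup_noncommuting:
  assumes A1: "A1_subgroup p H G"
  shows "\<exists>e j' k' l' j k l. P e j' k' l' \<in> H \<and> P 0 j k l \<in> H \<and>
    P e j' k' l' \<otimes> P 0 j k l \<noteq> P 0 j k l \<otimes> P e j' k' l'"
proof -
  have H: "subgroup H G" and nc: "\<not> comm_group (G\<lparr>carrier := H\<rparr>)"
    using A1 by (auto simp: A1_subgroup_def A1_group_def)
  note [simp] = subgroup.mem_carrier[OF H]
  have *: "?thesis" if "P i j k l \<in> H" "P i' j' k' l' \<in> H"
      "P i j k l \<otimes> P i' j' k' l' \<noteq> P i' j' k' l' \<otimes> P i j k l" for i j k l i' j' k' l'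
    using that
  proof (induction "nat \<bar>i'\<bar>" arbitrary: i j k l i' j' k' l' rule: less_induct)
    case less
    show ?case
    proof (cases "i' = 0")
      case True
      with less.prems show ?thesis by blast
    next
      case False
      obtain j1 k1 l1 where q: "P i' j' k' l' [^] (- (i div i')) = P (i' * - (i div i')) j1 k1 l1"
        using P_int_pow by blast
      have "i + i' * - (i div i') = i mod i'"
        by (simp add: minus_div_mult_eq_mod[symmetric] mult.commute)
      then obtain j2 k2 l2 where
        x: "P i j k l \<otimes> P i' j' k' l' [^] (- (i div i')) = P (i mod i') j2 k2 l2"
        unfolding q P_mult by simp
      have "P (i mod i') j2 k2 l2 \<in> H"
        unfolding x[symmetric] using less.prems H
        by (intro subgroup.m_closed subgroup_int_pow_closed)
      moreover have "nat \<bar>i mod i'\<bar> < nat \<bar>i'\<bar>"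
        using False abs_mod_less by fastforce
      moreover have "P i' j' k' l' \<otimes> P (i mod i') j2 k2 l2 \<noteq> P (i mod i') j2 k2 l2 \<otimes> P i' j' k' l'"
      proof
        assume eq: "P i' j' k' l' \<otimes> P (i mod i') j2 k2 l2 = P (i mod i') j2 k2 l2 \<otimes> P i' j' k' l'"
        let ?z = "P i' j' k' l'" and ?q = "P i' j' k' l' [^] (- (i div i'))"
        have zq: "?z \<otimes> ?q = ?q \<otimes> ?z"
          using int_pow_comm[of ?z ?z] by simp
        have "?z \<otimes> P i j k l \<otimes> ?q = P i j k l \<otimes> ?z \<otimes> ?q"
          using eq unfolding x[symmetric] by (simp add: m_assoc zq)
        then show False
          using less.prems(3) by simp
      qed
      ultimately show ?thesis
        using less.hyps less.prems by blast
    qed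
  qed
  obtain g h where "g \<in> H" "h \<in> H" "g \<otimes> h \<noteq> h \<otimes> g"
    using nc comm_group_subgroup_iff[OF H] by blast
  moreover from this obtain i j k l i' j' k' l' where "g = P i j k l" "h = P i' j' k' l'"
    using P_cases by (metis subgroup.mem_carrier[OF H])
  ultimately show ?thesis
    using * by blast
qed

lemma prime_dvd_mult_iff_int: "int p dvd i * j \<longleftrightarrow> int p dvd i \<or> int p dvd j"
  using p by (simp add: prime_dvd_mult_iff)

text \<open>For x with \<open>a\<close>-exponent e and z with \<open>b\<close>-exponent j, the
  double commutator [x, [x, z]] is \<open>y\<close> to the power e * e * j. It is trivial in a
  minimal non-abelian subgroup, hence p divides e or j.\<close>

lemma A1_subgroup_generators:
  assumes A1: "A1_subgroup p H G"
  obtains e j' k' l' j k l where "P e j' k' l' \<in> H" "P 0 j k l \<in> H"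
    "generate G {P e j' k' l', P 0 j k l} = H" "int p dvd e \<or> int p dvd j"
    "\<not> (int p ^ 2 dvd e * j \<and> int p dvd e * k - j * tri e)"
proof -
  obtain e j' k' l' j k l where H: "P e j' k' l' \<in> H" "P 0 j k l \<in> H" and
    nc: "P e j' k' l' \<otimes> P 0 j k l \<noteq> P 0 j k l \<otimes> P e j' k' l'"
    using A1_subgroup_noncommuting[OF A1] by blast
  have "heisenberg_triple G (P e j' k' l') (P 0 0 (e * j) (e * k - j * tri e)) (P 0 0 0 (e * (e * j)))"
    by (rule heisenberg_tripleI) (simp_all add: commutator_P P_commute_iff P_mult add.commute)
  then have "P 0 0 0 (e * (e * j)) = \<one>"
    by (rule heisenberg_triple.A1_subgroup_trivial_commutator[OF _ A1 H]) (simp add: commutator_P)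
  then have "int p dvd e \<or> int p dvd j"
    by (auto simp: P_eq_one_iff prime_dvd_mult_iff_int)
  then show thesis
    by (rule that[OF H A1_subgroup_generate[OF A1 H nc] _ nc[unfolded P_commute_iff]])
qed

text \<open>Generators x and z generally have orders up to p^n and p^m modulo \<open>K\<close>.
  Since p divides the \<open>a\<close>-exponent of x or the \<open>b\<close>-exponent of z, one of
  these bounds drops by a factor p; \<open>K\<close> itself contributes p^2.\<close>

lemma card_A1_subgroup_le:
  assumes A1: "A1_subgroup p H G"
  shows "card H \<le> p ^ (n + m + 1)"
proof -
  obtain e j' k' l' j k l where gen: "generate G {P e j' k' l', P 0 j k l} = H"
    and dvd: "int p dvd e \<or> int p dvd j"
    by (rule A1_subgroup_generators[OF A1])
  have pej: "int p dvd e * j"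
    using dvd by (simp add: prime_dvd_mult_iff_int)
  interpret heisenberg_triple G "P e j' k' l'" "P 0 j k l" "P 0 0 (e * j) (e * k - j * tri e)"
    using pej by (rule heisenberg_triple_P)
  note le = card_generate_le[OF subgroup_K card_K(1) K_central K_I[OF pej], unfolded gen]
  have p0: "0 < p"
    using p by (rule prime_gt_0_nat)
  obtain M N where "card H \<le> M * N * card K" "M * N = p ^ (n + m - 1)"
    using dvd
  proof
    assume "int p dvd e"
    then obtain e' where "e = int p * e'" by blast
    then have "P e j' k' l' [^] (p ^ (n - 1)) \<in> K"
      unfolding \<open>e = int p * e'\<close> P_pow_p_n' P_mult by auto
    moreover have "P 0 j k l [^] (p ^ m) \<in> K"
      by (auto simp: P_pow_p_m)
    ultimately have "card H \<le> p ^ (n - 1) * p ^ m * card K"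
      using le p0 by simp
    then show thesis
      using that[of "p ^ (n - 1)" "p ^ m"] m_less_n by (simp add: power_add[symmetric])
  next
    assume "int p dvd j"
    then obtain j2 where j2: "j = int p * j2" by blast
    have "P 0 j k l [^] (p ^ (m - 1)) =
        P 0 (int p ^ m * j2) 0 0 \<otimes> P 0 0 (k * int p ^ (m - 1)) (l * int p ^ (m - 1))"
      using m_ge_2 by (cases m) (simp_all add: P_pow P_mult j2 mult_ac)
    also have "\<dots> \<in> K"
      using m_ge_2 unfolding P_b_pow P_mult by (auto simp: dvd_power)
    finally have "P 0 j k l [^] (p ^ (m - 1)) \<in> K" .
    moreover have "P e j' k' l' [^] (p ^ n) \<in> K"
      by (auto simp: P_pow_p_n)
    ultimately have "card H \<le> p ^ n * p ^ (m - 1) * card K"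
      using le p0 by simp
    then show thesis
      using that[of "p ^ n" "p ^ (m - 1)"] m_ge_2 by (simp add: power_add[symmetric])
  qed
  then have "card H \<le> p ^ (n + m - 1) * p ^ 2"
    using card_K(2) by (metis le_trans mult_le_mono2)
  also have "\<dots> = p ^ (n + m + 1)"
    using m_less_n by (simp add: power_add[symmetric])
  finally show ?thesis .
qed

end

section \<open>Lower bounds for the indices\<close>

context metabelian_tower
begin

lemma p_pos: "0 < p"
  using p by (rule prime_gt_0_nat)

lemma order_le_index:
  assumes "subgroup H G" "card H \<le> p ^ r" "r + s = n + m + 3"
  shows "p ^ s \<le> card (rcosets H)"
proof -
  have "p ^ r * p ^ s \<le> card (rcosets H) * card H"
    using order_ge lagrange[OF assms(1)] assms(3) by (simp add: power_add[symmetric])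
  also have "\<dots> \<le> p ^ r * card (rcosets H)"
    using assms(2) by (simp add: mult.commute)
  finally show ?thesis
    using p_pos by simp
qed

lemma index_power_p:
  assumes "subgroup H G"
  shows "\<exists>s. card (rcosets H) = p ^ s"
proof -
  obtain N where "order G = p ^ N"
    using p_group by (auto simp: finite_p_group_def)
  then have "card (rcosets H) dvd p ^ N"
    using lagrange[OF assms] by (metis dvd_triv_left)
  then show ?thesis
    using divides_primepow_nat[OF p] by blast
qed

lemma A1_subgroup_index:
  assumes "A1_subgroup p H G"
  shows "\<exists>s\<ge>2. card (rcosets H) = p ^ s"
proof -
  have H: "subgroup H G"
    using assms by (simp add: A1_subgroup_def)
  obtain s where s: "card (rcosets H) = p ^ s"
    using index_power_p[OF H] by blast
  have "p ^ 2 \<le> p ^ s"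
    using order_le_index[OF H card_A1_subgroup_le[OF assms], of 2] s by simp
  then have "2 \<le> s"
    by (rule power_le_imp_le_exp[OF prime_gt_1_nat[OF p]])
  with s show ?thesis by blast
qed

lemma P_0_0_pow_p: "P 0 0 (int p * k) l [^] p = \<one>"
  using P_pow_abelian[of 0 "int p * k" l "int p"]
  by (simp add: int_pow_int P_eq_one_iff power2_eq_square)

text \<open>The pair \<open>a\<close>, \<open>c\<close> has the central commutator \<open>y\<close>
  of order p. Modulo \<open>K\<close> the orders are at most p^n and p, so the subgroup has order at
  most p^(n+3).\<close>

lemma A1_subgroup_index_ge_p_m: "\<exists>H. A1_subgroup p H G \<and> p ^ m \<le> card (rcosets H)"
proof -
  let ?H = "generate G {P 1 0 0 0, P 0 0 1 0}"
  interpret heisenberg_triple G "P 1 0 0 0" "P 0 0 1 0" "P 0 0 0 1"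
    using heisenberg_triple_P[of 1 0 0 0 0 1 0] by simp
  have "P 0 0 0 1 \<noteq> \<one>"
    using p_gt_1 by (simp add: P_eq_one_iff)
  then have A1: "A1_subgroup p ?H G"
    using p p_group P_0_0_pow_p[of 0 1] by (intro A1_subgroup_generateI) simp_all
  have "P 1 0 0 0 [^] (p ^ n) \<in> K"
    by (auto simp: P_pow_p_n)
  moreover have "P 0 0 1 0 [^] p \<in> K"
    by (auto simp: P_pow)
  ultimately have "card ?H \<le> p ^ n * p * card K"
    using card_generate_le[OF subgroup_K card_K(1) K_central K_I[of 0]] p_pos by simp
  also have "\<dots> \<le> p ^ (n + 3)"
    using card_K(2) p_pos by (simp add: power_add power2_eq_square power3_eq_cube)
  finally have "p ^ m \<le> card (rcosets ?H)"
    using A1 by (intro order_le_index[of _ "n + 3"]) (simp_all add: A1_subgroup_def)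
  with A1 show ?thesis by blast
qed

lemma K_lineI:
  assumes "[l = t * k] (mod int p)"
  shows "P 0 0 (int p * k) l \<in> K_line t"
proof -
  have "P 0 0 (int p * k) l = P 0 0 (int p * k) (t * k)"
    using assms by (intro P_eqI) simp_all
  then show ?thesis by (auto simp: K_line_def)
qed

text \<open>The commutator of \<open>a\<close> with b^p c^t is c^p y^t, which spans
  \<open>K_line t\<close>. The two congruences say that a^(p^n) and (b^p c^t)^p lie on the same
  line, so \<open>K_line t\<close> can replace \<open>K\<close> in the bound for the order and a
  factor p is gained.\<close>

lemma A1_subgroup_index_ge_p_3:
  assumes m: "m = 2" and t: "[w12 = t * w11] (mod int p)" "[w22 = t * (w21 + t)] (mod int p)"
  shows "\<exists>H. A1_subgroup p H G \<and> p ^ 3 \<le> card (rcosets H)"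
proof -
  let ?H = "generate G {P 1 0 0 0, P 0 (int p) t 0}"
  interpret heisenberg_triple G "P 1 0 0 0" "P 0 (int p) t 0" "P 0 0 (int p * 1) (t * 1)"
    using heisenberg_triple_P[of 1 "int p" 0 0 0 t 0] by simp
  have "P 0 0 (int p * 1) (t * 1) \<noteq> \<one>"
    using p_gt_1 by (simp add: P_eq_one_iff power2_eq_square)
  then have A1: "A1_subgroup p ?H G"
    by (intro A1_subgroup_generateI[OF p p_group _ P_0_0_pow_p])
  have "P 1 0 0 0 [^] (p ^ n) \<in> K_line t"
    using K_lineI[OF t(1)] by (simp add: P_pow_p_n)
  moreover have "P 0 (int p) t 0 [^] p \<in> K_line t"
  proof -
    have "P 0 (int p) t 0 [^] p = P 0 (int p ^ m * 1) 0 0 \<otimes> P 0 0 (int p * t) 0"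
      unfolding m by (simp add: P_pow P_mult power2_eq_square mult.commute)
    also have "\<dots> = P 0 0 (int p * (w21 + t)) w22"
      unfolding P_b_pow by (simp add: P_mult distrib_left)
    finally show ?thesis
      using K_lineI[OF t(2)] by simp
  qed
  moreover have "P 0 0 (int p * 1) (t * 1) \<in> K_line t"
    by (rule K_lineI) simp
  ultimately have "card ?H \<le> p ^ n * p * card (K_line t)"
    using card_generate_le[OF subgroup_K_line card_K_line(1)] K_central K_line_subset p_pos
    by (meson subsetD zero_less_power)
  also have "\<dots> \<le> p ^ (n + 2)"
    using card_K_line(2) p_pos by (simp add: power_add power2_eq_square)
  finally have "p ^ 3 \<le> card (rcosets ?H)"
    using A1 m by (intro order_le_index[of _ "n + 2"]) (simp_all add: A1_subgroup_def)
  with A1 show ?thesis by blast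
qed

end

section \<open>Coset covers\<close>

lemma prime_power_linear_solve:
  fixes e i :: int
  assumes "Factorial_Ring.prime p" "\<not> int p dvd e"
  obtains r d where "i = e * r + int p ^ N * d"
proof -
  have "coprime e (int p ^ N)"
    using assms prime_imp_coprime[of "int p" e] by (simp add: coprime_commute)
  then obtain s where "[e * s = 1] (mod int p ^ N)"
    using cong_solve_coprime_int by blast
  then have "[e * (s * i) = i] (mod int p ^ N)"
    using cong_scalar_right[of "e * s" 1 "int p ^ N" i] by (simp add: mult.assoc)
  then show thesis
    using that by (metis cong_iff_lin)
qed

context metabelian_tower
begin

context
  fixes H
  assumes H: "subgroup H G"
begin

text \<open>A suitable power of the given element removes the \<open>a\<close>-part up to a multiple
  of p^n, and a^(p^n) lies in \<open>K\<close>, so it is absorbed into the exponents of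
  \<open>c\<close> and \<open>y\<close>. The instances are q = 1 and q = p.\<close>

lemma cover_a:
  assumes x: "P (q * e) j' k' l' \<in> H" and e: "\<not> int p dvd e" and q: "q * int p ^ N = int p ^ n"
  shows "\<exists>h\<in>H. \<exists>j k l. P (q * i) j0 k0 l0 = h \<otimes> P 0 j k l"
proof -
  obtain r d where i: "i = e * r + int p ^ N * d"
    using prime_power_linear_solve[OF p e] by blast
  obtain j1 k1 l1 where pow: "P (q * e) j' k' l' [^] (-r) = P (q * e * - r) j1 k1 l1"
    using P_int_pow by blast
  let ?h = "P (q * e) j' k' l' [^] r"
  have h: "?h \<in> H"
    using subgroup_int_pow_closed[OF H x] .
  have "q * e * - r + q * i = int p ^ n * d"
    unfolding i q[symmetric] by (simp add: algebra_simps)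
  then obtain j2 k2 l2 where "P (q * e) j' k' l' [^] (-r) \<otimes> P (q * i) j0 k0 l0 = P (int p ^ n * d) j2 k2 l2"
    unfolding pow P_mult by simp
  also have "\<dots> = P (int p ^ n * d) 0 0 0 \<otimes> P 0 j2 k2 l2"
    by (simp add: P_mult)
  also have "\<dots> = P 0 j2 (int p * (w11 * d) + k2) (w12 * d + l2)"
    unfolding P_a_pow by (simp add: P_mult)
  finally have "inv ?h \<otimes> P (q * i) j0 k0 l0 = P 0 j2 (int p * (w11 * d) + k2) (w12 * d + l2)"
    by (simp add: int_pow_neg)
  then have "P (q * i) j0 k0 l0 = ?h \<otimes> P 0 j2 (int p * (w11 * d) + k2) (w12 * d + l2)"
    by (simp add: inv_solve_left')
  with h show ?thesis by blast
qed

text \<open>The analogue of \<open>cover_a\<close> for the exponent of \<open>b\<close>; the summand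
  j0 carries the remainder modulo q that the given element cannot reach.\<close>

lemma cover_b:
  assumes z: "P 0 (q * s) k' l' \<in> H" and s: "\<not> int p dvd s" and q: "q * int p ^ N = int p ^ m"
  shows "\<exists>h\<in>H. \<exists>k l. P 0 (q * i + j0) k0 l0 = h \<otimes> P 0 j0 k l"
proof -
  obtain r d where i: "i = s * r + int p ^ N * d"
    using prime_power_linear_solve[OF p s] by blast
  let ?h = "P 0 (q * s) k' l' [^] r"
  let ?k = "- k' * r + k0 + int p * (w21 * d)" and ?l = "- l' * r + l0 + w22 * d"
  have h: "?h \<in> H"
    using subgroup_int_pow_closed[OF H z] .
  have b: "q * i + j0 = q * s * r + int p ^ m * d + j0"
    unfolding i q[symmetric] by (simp add: algebra_simps)
  have "P 0 (q * i + j0) k0 l0 =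
      P 0 (q * s * r) (k' * r) (l' * r) \<otimes> P 0 (int p ^ m * d) 0 0 \<otimes> P 0 j0 (- k' * r + k0) (- l' * r + l0)"
    unfolding b P_mult by simp
  also have "\<dots> = ?h \<otimes> (P 0 (int p ^ m * d) 0 0 \<otimes> P 0 j0 (- k' * r + k0) (- l' * r + l0))"
    by (simp add: P_pow_abelian m_assoc)
  also have "P 0 (int p ^ m * d) 0 0 \<otimes> P 0 j0 (- k' * r + k0) (- l' * r + l0) = P 0 j0 ?k ?l"
    unfolding P_b_pow by (simp add: P_mult algebra_simps)
  finally show ?thesis
    using h by blast
qed

lemma P_cancel:
  assumes "P 0 0 (k * d) (l * d) \<in> H" "\<not> int p dvd d"
  shows "P 0 0 k l \<in> H"
  using subgroup_int_pow_cancel[OF p p_group H, of "P 0 0 k l" d] assms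
  by (simp add: P_pow_abelian)

lemma P_line: "P 0 0 k l \<in> H \<Longrightarrow> P 0 0 (k * d) (l * d) \<in> H"
  using subgroup_int_pow_closed[OF H, of "P 0 0 k l" d] by (simp add: P_pow_abelian)

lemma P_add: "P 0 0 k l \<in> H \<Longrightarrow> P 0 0 k' l' \<in> H \<Longrightarrow> P 0 0 (k + k') (l + l') \<in> H"
  using subgroup.m_closed[OF H] by (fastforce simp: P_mult)

text \<open>In coordinates with respect to \<open>c [^] p\<close> and \<open>y\<close> the two
  elements are (1, t) and (k, l), with determinant l - t * k; when it is nonzero modulo p they span
  the plane \<open>K\<close>.\<close>

lemma K_subset_of_independent:
  assumes t: "P 0 0 (int p) t \<in> H" and v: "P 0 0 (int p * k) l \<in> H" and kl: "\<not> int p dvd l - t * k"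
  shows "K \<subseteq> H"
proof -
  have "P 0 0 (int p * k + int p * - k) (l + t * - k) \<in> H"
    by (rule P_add[OF v P_line[OF t]])
  then have "P 0 0 (0 * (l - t * k)) (1 * (l - t * k)) \<in> H"
    by (simp add: mult.commute)
  then have y: "P 0 0 0 1 \<in> H"
    using kl by (rule P_cancel)
  have "P 0 0 (int p + 0 * - t) (t + 1 * - t) \<in> H"
    by (rule P_add[OF t P_line[OF y]])
  then have c: "P 0 0 (int p) 0 \<in> H" by simp
  have "P 0 0 (int p * k + 0 * l) (0 * k + 1 * l) \<in> H" for k l
    by (rule P_add[OF P_line[OF c] P_line[OF y]])
  then show ?thesis
    by (auto simp: K_def)
qed

lemma cover_c:
  assumes "K \<subseteq> H"
  shows "\<exists>h\<in>H. P 0 j k l = h \<otimes> P 0 j (k mod int p) 0"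
proof -
  have "P 0 j k l = P 0 0 (int p * (k div int p)) l \<otimes> P 0 j (k mod int p) 0"
    by (simp add: P_mult)
  moreover have "P 0 0 (int p * (k div int p)) l \<in> H"
    using assms K_I[of "int p * (k div int p)"] by auto
  ultimately show ?thesis by blast
qed

text \<open>Coset representatives are b^j c^k with 0 <= j, k < p: powers of x remove
  \<open>a\<close>, powers of z reduce the exponent of \<open>b\<close> modulo p, and
  \<open>K\<close> reduces that of \<open>c\<close>.\<close>

lemma index_le_p_2_outside:
  assumes x: "P e j' k' l' \<in> H" "\<not> int p dvd e"
    and z: "P 0 (int p * s) k l \<in> H" "\<not> int p dvd s" and K: "K \<subseteq> H" and m: "m = 2"
  shows "card (rcosets H) \<le> p ^ 2"
proof -
  let ?f = "\<lambda>(j, k). P 0 j k 0" and ?D = "{0..<int p} \<times> {0..<int p}"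
  have "card (rcosets H) \<le> card (?f ` ?D)"
  proof (rule card_rcosets_le[OF H])
    fix g assume "g \<in> carrier G"
    then obtain i j0 k0 l0 where "g = P i j0 k0 l0"
      using P_cases by blast
    then obtain h1 j1 k1 l1 where h1: "h1 \<in> H" "g = h1 \<otimes> P 0 j1 k1 l1"
      using cover_a[of 1 e j' k' l' n i j0 k0 l0] x by auto
    obtain h2 k2 l2 where h2: "h2 \<in> H" "P 0 j1 k1 l1 = h2 \<otimes> P 0 (j1 mod int p) k2 l2"
      using cover_b[OF z, of 1 "j1 div int p" "j1 mod int p" k1 l1] m by (auto simp: power2_eq_square)
    obtain h3 where h3: "h3 \<in> H" "P 0 (j1 mod int p) k2 l2 = h3 \<otimes> P 0 (j1 mod int p) (k2 mod int p) 0"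
      using cover_c[OF K] by blast
    have "g = (h1 \<otimes> h2 \<otimes> h3) \<otimes> P 0 (j1 mod int p) (k2 mod int p) 0"
      using h1 h2 h3 subgroup.mem_carrier[OF H] by (simp add: m_assoc)
    moreover have "h1 \<otimes> h2 \<otimes> h3 \<in> H"
      using h1 h2 h3 by (simp add: subgroup.m_closed[OF H])
    moreover have "P 0 (j1 mod int p) (k2 mod int p) 0 \<in> ?f ` ?D"
      using p_gt_1 by (intro image_eqI[of _ _ "(j1 mod int p, k2 mod int p)"]) auto
    ultimately show "\<exists>h\<in>H. \<exists>t\<in>?f ` ?D. t \<in> carrier G \<and> g = h \<otimes> t"
      by (blast intro: P_closed)
  qed simp
  also have "\<dots> \<le> card ?D"
    by (rule card_image_le) simp
  finally show ?thesis
    by (simp add: power2_eq_square)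
qed

text \<open>Here \<open>H\<close> contains \<open>c\<close> and \<open>y\<close>, and the powers of
  \<open>b\<close> below p^2 represent all cosets, since b^(p^2) lies in \<open>K\<close>.\<close>

lemma index_le_p_2_cyclic:
  assumes x: "P e j' k' l' \<in> H" "\<not> int p dvd e" and c: "P 0 0 1 0 \<in> H" and K: "K \<subseteq> H" and m: "m = 2"
  shows "card (rcosets H) \<le> p ^ 2"
proof -
  let ?f = "\<lambda>j. P 0 j 0 0" and ?D = "{0..<int p ^ 2}"
  have P_H: "P 0 0 k l \<in> H" for k l
    using P_add[OF P_line[OF c, of k], of 0 l] K by auto
  have card_D: "card ?D = p ^ 2"
    by (metis card_atLeastZeroLessThan_int nat_int of_nat_power)
  have "card (rcosets H) \<le> card (?f ` ?D)"
  proof (rule card_rcosets_le[OF H])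
    fix g assume "g \<in> carrier G"
    then obtain i j0 k0 l0 where "g = P i j0 k0 l0"
      using P_cases by blast
    then obtain h1 j1 k1 l1 where h1: "h1 \<in> H" "g = h1 \<otimes> P 0 j1 k1 l1"
      using cover_a[of 1 e j' k' l' n i j0 k0 l0] x by auto
    let ?q = "j1 div int p ^ 2" and ?r = "j1 mod int p ^ 2"
    have "P 0 j1 k1 l1 = P 0 (int p ^ m * ?q) 0 0 \<otimes> P 0 0 k1 l1 \<otimes> P 0 ?r 0 0"
      unfolding m P_mult by simp
    moreover have "P 0 (int p ^ m * ?q) 0 0 \<otimes> P 0 0 k1 l1 \<in> H"
      unfolding P_b_pow using P_H by (simp add: P_mult)
    ultimately have "g = (h1 \<otimes> (P 0 (int p ^ m * ?q) 0 0 \<otimes> P 0 0 k1 l1)) \<otimes> P 0 ?r 0 0"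
      and "h1 \<otimes> (P 0 (int p ^ m * ?q) 0 0 \<otimes> P 0 0 k1 l1) \<in> H"
      using h1 subgroup.mem_carrier[OF H] subgroup.m_closed[OF H] by (simp_all add: m_assoc)
    moreover have "P 0 ?r 0 0 \<in> ?f ` ?D"
      using p_gt_1 by (intro imageI) simp
    ultimately show "\<exists>h\<in>H. \<exists>t\<in>?f ` ?D. t \<in> carrier G \<and> g = h \<otimes> t"
      by (blast intro: P_closed)
  qed simp
  also have "\<dots> \<le> card ?D"
    by (rule card_image_le) simp
  finally show ?thesis
    by (simp only: card_D)
qed

text \<open>Representatives are c^k a^i with 0 <= k, i < p; powers of x only reach multiples of p in
  the exponent of \<open>a\<close>.\<close>

lemma index_le_p_2_inside:
  assumes x: "P (int p * e) j' k' l' \<in> H" "\<not> int p dvd e"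
    and z: "P 0 j k l \<in> H" "\<not> int p dvd j" and K: "K \<subseteq> H"
  shows "card (rcosets H) \<le> p ^ 2"
proof -
  let ?f = "\<lambda>(k, i). P 0 0 k 0 \<otimes> P i 0 0 0" and ?D = "{0..<int p} \<times> {0..<int p}"
  have "card (rcosets H) \<le> card (?f ` ?D)"
  proof (rule card_rcosets_le[OF H])
    fix g assume "g \<in> carrier G"
    then obtain i0 j0 k0 l0 where g: "g = P i0 j0 k0 l0"
      using P_cases by blast
    let ?q = "i0 div int p" and ?r = "i0 mod int p"
    \<comment> \<open>The remainder of \<open>a\<close> is split off on the right, where right
      cosets tolerate it; the corrected exponents undo those that \<open>P_mult\<close>
      introduces.\<close>
    have g2: "g = P (int p * ?q) j0 (k0 + ?r * j0) (l0 + ?r * (k0 + ?r * j0) - j0 * tri ?r) \<otimes> P ?r 0 0 0"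
      unfolding g P_mult by simp
    have "int p * int p ^ (n - 1) = int p ^ n"
      using m_less_n by (simp flip: power_Suc)
    then obtain h1 j1 k1 l1 where h1: "h1 \<in> H"
      "P (int p * ?q) j0 (k0 + ?r * j0) (l0 + ?r * (k0 + ?r * j0) - j0 * tri ?r) = h1 \<otimes> P 0 j1 k1 l1"
      using cover_a[OF x] by blast
    obtain h2 k2 l2 where h2: "h2 \<in> H" "P 0 j1 k1 l1 = h2 \<otimes> P 0 0 k2 l2"
      using cover_b[of 1 j k l m j1 0 k1 l1] z by auto
    obtain h3 where h3: "h3 \<in> H" "P 0 0 k2 l2 = h3 \<otimes> P 0 0 (k2 mod int p) 0"
      using cover_c[OF K] by blast
    have "g = (h1 \<otimes> h2 \<otimes> h3) \<otimes> (P 0 0 (k2 mod int p) 0 \<otimes> P ?r 0 0 0)"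
      using g2 h1 h2 h3 subgroup.mem_carrier[OF H] by (simp add: m_assoc)
    moreover have "h1 \<otimes> h2 \<otimes> h3 \<in> H"
      using h1 h2 h3 by (simp add: subgroup.m_closed[OF H])
    moreover have "P 0 0 (k2 mod int p) 0 \<otimes> P ?r 0 0 0 \<in> ?f ` ?D"
      using p_gt_1 by (intro image_eqI[of _ _ "(k2 mod int p, ?r)"]) auto
    ultimately show "\<exists>h\<in>H. \<exists>t\<in>?f ` ?D. t \<in> carrier G \<and> g = h \<otimes> t"
      by (blast intro: P_closed m_closed)
  qed simp
  also have "\<dots> \<le> card ?D"
    by (rule card_image_le) simp
  finally show ?thesis
    by (simp add: power2_eq_square)
qed

end

text \<open>The absence of a common root forces \<open>K\<close> into \<open>H\<close>, after which
  one of the three covers applies. The cases are: p divides e; p divides neither e nor j / p; p does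
  not divide e but p^2 divides j.\<close>

lemma A1_subgroup_index_le_p_2:
  assumes A1: "A1_subgroup p H G" and m: "m = 2"
    and no_root: "\<And>t. \<not> ([w12 = t * w11] (mod int p) \<and> [w22 = t * (w21 + t)] (mod int p))"
  shows "card (rcosets H) \<le> p ^ 2"
proof -
  obtain e j' k' l' j k l where x: "P e j' k' l' \<in> H" and z: "P 0 j k l \<in> H"
    and dvd: "int p dvd e \<or> int p dvd j"
    and nc: "\<not> (int p ^ 2 dvd e * j \<and> int p dvd e * k - j * tri e)"
    by (rule A1_subgroup_generators[OF A1])
  have H: "subgroup H G"
    using A1 by (simp add: A1_subgroup_def)
  have "P 0 0 (e * j) (e * k - j * tri e) = commutator G (P e j' k' l') (P 0 j k l)"
    by (simp add: commutator_P)
  also have "\<dots> \<in> H"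
    unfolding commutator_def using x z by (simp add: subgroup.m_closed[OF H] subgroup.m_inv_closed[OF H])
  finally have u: "P 0 0 (e * j) (e * k - j * tri e) \<in> H" .
  have pow_H: "g [^] (r::nat) \<in> H" if "g \<in> H" for g r
    using subgroup_int_pow_closed[OF H that, of "int r"] by (simp add: int_pow_int)
  show ?thesis
  proof (cases "int p dvd e")
    case True
    then obtain e' where e: "e = int p * e'" by blast
    have tri: "int p dvd tri e"
      using dvd_tri[of "int p" e] True odd_p by simp
    \<comment> \<open>As p divides both e and tri e, the \<open>y\<close>-part of the commutator
      vanishes, so non-commutation must show in the exponent of \<open>c\<close>.\<close>
    with nc have e'j: "\<not> int p dvd e' * j"
      unfolding e by (auto simp: power2_eq_square)
    then have e': "\<not> int p dvd e'" and j: "\<not> int p dvd j"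
      by auto
    have "P 0 0 (e * j) (e * k - j * tri e) = P 0 0 (int p * (e' * j)) (0 * (e' * j))"
      using tri unfolding e by (intro P_eqI) (simp_all add: cong_0_iff mult.assoc)
    with u have c: "P 0 0 (int p) 0 \<in> H"
      using P_cancel[OF H _ e'j, of "int p" 0] by simp
    \<comment> \<open>With c^p in \<open>H\<close>, the \<open>c\<close>-component of any element of
      \<open>K\<close> in \<open>H\<close> can be discarded. Applied to the power p^m of z and the
      power p^(n-1) of x, this extracts y^w22 and then y^w12.\<close>
    have y_part: "P 0 0 0 l \<in> H" if "P 0 0 (int p * i) l \<in> H" for i l
      using P_add[OF H that P_line[OF H c, of "- i"]] by simp
    have "P 0 j k l [^] (p ^ m) \<in> H"
      by (rule pow_H[OF z])
    then have "P 0 0 (0 * j) (w22 * j) \<in> H"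
      using y_part unfolding P_pow_p_m by simp
    then have w22: "P 0 0 0 w22 \<in> H"
      using P_cancel[OF H _ j] by blast
    let ?q = "int p ^ (n - 1 - m) * j'"
    have "P e j' k' l' [^] (p ^ (n - 1)) \<in> H"
      by (rule pow_H[OF x])
    then have "P 0 0 (int p * (w11 * e' + w21 * ?q)) (w12 * e' + w22 * ?q) \<in> H"
      unfolding e P_pow_p_n' P_mult by (simp add: distrib_left)
    then have "P 0 0 (0 + 0 * - ?q) (w12 * e' + w22 * ?q + w22 * - ?q) \<in> H"
      by (intro P_add[OF H _ P_line[OF H w22]] y_part)
    then have "P 0 0 (0 * e') (w12 * e') \<in> H"
      by simp
    then have w12: "P 0 0 0 w12 \<in> H"
      using P_cancel[OF H _ e'] by blast
    \<comment> \<open>The value t = 0 is not a common root.\<close>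
    have "\<not> int p dvd w12 \<or> \<not> int p dvd w22"
      using no_root[of 0] by (auto simp: cong_0_iff)
    then have "K \<subseteq> H"
      using K_subset_of_independent[OF H c, of 0] w12 w22 by auto
    then show ?thesis
      using index_le_p_2_inside[OF H x[unfolded e] e' z j] by blast
  next
    case e: False
    then obtain s where s: "j = int p * s"
      using dvd by blast
    show ?thesis
    proof (cases "int p dvd s")
      case False
      \<comment> \<open>The slope t is k / s modulo p; with it the commutator becomes the power e *
        s of c^p y^t.\<close>
      obtain t d where k: "k = s * t + int p ^ 1 * d"
        by (rule prime_power_linear_solve[OF p False])
      have es: "\<not> int p dvd e * s"
        using e False by (simp add: prime_dvd_mult_iff_int)
      have "P 0 0 (e * j) (e * k - j * tri e) = P 0 0 (int p * (e * s)) (t * (e * s))"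
        unfolding s k by (intro P_eqI) (simp_all add: cong_iff_dvd_diff algebra_simps)
      with u have t: "P 0 0 (int p) t \<in> H"
        using P_cancel[OF H _ es] by simp
      have "P 0 j k l [^] p = P 0 (int p ^ m * s) (k * int p) (l * int p)"
        by (simp add: P_pow s m power2_eq_square mult_ac)
      also have "\<dots> = P 0 (int p ^ m * s) (int p * k) 0"
        by (intro P_eqI) (simp_all add: cong_0_iff mult.commute)
      also have "\<dots> = P 0 (int p ^ m * s) 0 0 \<otimes> P 0 0 (int p * k) 0"
        by (simp add: P_mult)
      also have "\<dots> = P 0 0 (int p * (w21 * s + k)) (w22 * s)"
        unfolding P_b_pow by (simp add: P_mult distrib_left)
      also have "\<dots> = P 0 0 (int p * (w21 + t) * s) (w22 * s)"
        unfolding k by (intro P_eqI) (simp_all add: cong_iff_dvd_diff power2_eq_square algebra_simps)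
      finally have zp: "P 0 j k l [^] p = P 0 0 (int p * (w21 + t) * s) (w22 * s)" .
      have "P 0 j k l [^] p \<in> H"
        by (rule pow_H[OF z])
      then have w2: "P 0 0 (int p * (w21 + t)) w22 \<in> H"
        unfolding zp using P_cancel[OF H _ False] by blast
      have "P e j' k' l' [^] (p ^ n) \<in> H"
        by (rule pow_H[OF x])
      then have w1: "P 0 0 (int p * w11) w12 \<in> H"
        using P_cancel[OF H _ e, of "int p * w11" w12] by (simp add: P_pow_p_n mult.assoc)
      \<comment> \<open>The two differences are the determinants of (1, t) against the vectors of
        a^(p^n) and of z^p; since t is not a common root, one of them is nonzero.\<close>
      have "\<not> int p dvd w12 - t * w11 \<or> \<not> int p dvd w22 - t * (w21 + t)"
        using no_root[of t] by (simp add: cong_iff_dvd_diff)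
      then have "K \<subseteq> H"
        using K_subset_of_independent[OF H t] w1 w2 by blast
      then show ?thesis
        using index_le_p_2_outside[OF H x e z[unfolded s] False] m by blast
    next
      case True
      then obtain s2 where s2: "s = int p * s2" by blast
      have j: "j = int p ^ m * s2"
        by (simp add: s s2 m power2_eq_square)
      have "int p ^ 2 dvd e * j"
        by (simp add: j m)
      moreover have "int p dvd j * tri e"
        by (simp add: s)
      ultimately have k: "\<not> int p dvd e * k"
        using nc by (simp add: dvd_diff_left_iff)
      \<comment> \<open>Now the commutator is a nontrivial power of \<open>y\<close>, and the
        \<open>b\<close>-part of z lies in \<open>K\<close>; dividing out \<open>y\<close> leaves in
        \<open>H\<close> a power of \<open>c\<close> with exponent prime to p.\<close>
      have "P 0 0 (e * j) (e * k - j * tri e) = P 0 0 (0 * (e * k)) (1 * (e * k))"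
        by (intro P_eqI) (simp_all add: j m cong_iff_dvd_diff power2_eq_square)
      with u have y: "P 0 0 0 1 \<in> H"
        using P_cancel[OF H _ k] by metis
      have "P 0 j k l = P 0 (int p ^ m * s2) 0 0 \<otimes> P 0 0 k l"
        by (simp add: P_mult j)
      also have "\<dots> = P 0 0 (int p * (w21 * s2) + k) (w22 * s2 + l)"
        unfolding P_b_pow by (simp add: P_mult)
      finally have "P 0 0 (int p * (w21 * s2) + k + 0 * - (w22 * s2 + l))
          (w22 * s2 + l + 1 * - (w22 * s2 + l)) \<in> H"
        using P_add[OF H _ P_line[OF H y]] z by metis
      then have c': "P 0 0 (1 * (int p * (w21 * s2) + k)) (0 * (int p * (w21 * s2) + k)) \<in> H"
        by simp
      moreover have "\<not> int p dvd int p * (w21 * s2) + k"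
        using k by (auto simp: dvd_add_right_iff)
      ultimately have c: "P 0 0 1 0 \<in> H"
        by (rule P_cancel[OF H])
      have "P 0 0 (1 * i + 0 * r) (0 * i + 1 * r) \<in> H" for i r
        by (rule P_add[OF H P_line[OF H c] P_line[OF H y]])
      then have "K \<subseteq> H"
        by (auto simp: K_def)
      then show ?thesis
        using index_le_p_2_cyclic[OF H x e c] m by blast
    qed
  qed
qed

end

section \<open>The quadratic congruence\<close>

text \<open>Completing the square: 4 * (t * (b + t) - c) equals (2 * t + b)^2 - (b^2 + 4 * c). Zero
  counts as a square in \<open>QuadRes\<close>, which matches a double root.\<close>

lemma odd_prime_discriminant:
  fixes b c :: int
  assumes p: "Factorial_Ring.prime p" "odd p"
  shows "(\<exists>t. [c = t * (b + t)] (mod int p)) \<longleftrightarrow> QuadRes (int p) (b^2 + 4 * c)"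
proof
  assume "\<exists>t. [c = t * (b + t)] (mod int p)"
  then obtain t where "int p dvd c - t * (b + t)"
    by (auto simp: cong_iff_dvd_diff)
  then have "int p dvd -4 * (c - t * (b + t))"
    by (rule dvd_mult)
  also have "-4 * (c - t * (b + t)) = (2 * t + b)^2 - (b^2 + 4 * c)"
    by (simp add: power2_eq_square algebra_simps)
  finally show "QuadRes (int p) (b^2 + 4 * c)"
    unfolding QuadRes_def cong_iff_dvd_diff by blast
next
  assume "QuadRes (int p) (b^2 + 4 * c)"
  then obtain s where s: "int p dvd s^2 - (b^2 + 4 * c)"
    unfolding QuadRes_def cong_iff_dvd_diff by blast
  have "coprime 2 (int p)"
    using p(2) by simp
  then obtain h where h: "[2 * h = 1] (mod int p)"
    using cong_solve_coprime_int by blast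
  define t where "t = h * (s - b)"
  have "[2 * h * (s - b) = 1 * (s - b)] (mod int p)"
    using h by (rule cong_scalar_right)
  then have "int p dvd 2 * t - (s - b)"
    unfolding cong_iff_dvd_diff t_def by (simp add: mult.assoc)
  then have "int p dvd (2 * t - (s - b)) * (2 * t + b + s)"
    by (rule dvd_mult2)
  then have "int p dvd (2 * t - (s - b)) * (2 * t + b + s) + (s^2 - (b^2 + 4 * c))"
    using s by (rule dvd_add)
  also have "(2 * t - (s - b)) * (2 * t + b + s) + (s^2 - (b^2 + 4 * c)) = 4 * (t * (b + t) - c)"
    by (simp add: power2_eq_square algebra_simps)
  finally have "int p dvd 2 * (2 * (t * (b + t) - c))"
    by simp
  then have "int p dvd t * (b + t) - c"
    using \<open>coprime 2 (int p)\<close> by (metis coprime_commute coprime_dvd_mult_right_iff)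
  then show "\<exists>t. [c = t * (b + t)] (mod int p)"
    by (metis cong_iff_dvd_diff cong_sym)
qed

text \<open>If w11 vanishes modulo p, the first congruence says w12 = 0 for every t, and solvability
  is left to the discriminant. Otherwise it determines t = w12 / w11, and the question is whether
  this t satisfies the quadratic congruence.\<close>

lemma common_root_iff:
  fixes w11 w12 w21 w22 :: int
  assumes p: "Factorial_Ring.prime p" "odd p"
  shows "(\<nexists>t. [w12 = t * w11] (mod int p) \<and> [w22 = t * (w21 + t)] (mod int p)) \<longleftrightarrow>
    (\<not> [w12 = 0] (mod int p) \<and> \<not> [w11 * (w11 * w22 - w12 * w21) = w12^2] (mod int p)) \<or>
    ([w12 = 0] (mod int p) \<and> \<not> [w11 = 0] (mod int p) \<and> \<not> [w22 = 0] (mod int p)) \<or>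
    \<not> QuadRes (int p) (w21^2 + 4 * w22)"
proof -
  have prime: "int p dvd i * j \<longleftrightarrow> int p dvd i \<or> int p dvd j" for i j :: int
    using p(1) by (simp add: prime_dvd_mult_iff)
  have disc: "QuadRes (int p) (w21^2 + 4 * w22) \<longleftrightarrow> (\<exists>t. [w22 = t * (w21 + t)] (mod int p))"
    using odd_prime_discriminant[OF p, of w22 w21] by simp
  show ?thesis
  proof (cases "int p dvd w11")
    case True
    then have "[w12 = t * w11] (mod int p) \<longleftrightarrow> int p dvd w12" for t
      by (metis cong_0_iff cong_dvd_iff dvd_mult cong_sym cong_trans)
    moreover have "[w11 * (w11 * w22 - w12 * w21) = w12^2] (mod int p) \<longleftrightarrow> int p dvd w12"
      using True p(1) prime_dvd_power_iff[of "int p" 2 w12]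
      by (metis (no_types, lifting) cong_0_iff cong_dvd_iff cong_sym cong_trans dvd_mult2 pos2 prime_nat_int_transfer)
    ultimately show ?thesis
      using True unfolding disc by (auto simp: cong_0_iff)
  next
    case False
    then obtain s d where w12: "w12 = w11 * s + int p ^ 1 * d"
      using prime_power_linear_solve[OF p(1)] by metis
    have root: "[w12 = t * w11] (mod int p) \<longleftrightarrow> int p dvd s - t" for t
    proof -
      have "w12 - t * w11 = w11 * (s - t) + int p * d"
        by (simp add: w12 algebra_simps)
      then show ?thesis
        using False by (simp add: cong_iff_dvd_diff prime dvd_add_left_iff)
    qed
    have at_s: "[w22 = t * (w21 + t)] (mod int p) \<longleftrightarrow> [w22 = s * (w21 + s)] (mod int p)"
      if "int p dvd s - t" for t
    proof -
      have "[s = t] (mod int p)"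
        using that by (simp add: cong_iff_dvd_diff)
      then have "[s * (w21 + s) = t * (w21 + t)] (mod int p)"
        by (intro cong_mult cong_add) simp_all
      then show ?thesis
        by (meson cong_sym cong_trans)
    qed
    have "(\<nexists>t. [w12 = t * w11] (mod int p) \<and> [w22 = t * (w21 + t)] (mod int p)) \<longleftrightarrow>
        \<not> [w22 = s * (w21 + s)] (mod int p)"
    proof -
      have "int p dvd s - s" by simp
      then show ?thesis
        unfolding root using at_s by blast
    qed
    moreover have "[w11 * (w11 * w22 - w12 * w21) = w12^2] (mod int p) \<longleftrightarrow> [w22 = s * (w21 + s)] (mod int p)"
    proof -
      \<comment> \<open>Substituting w12 = w11 * s modulo p, the expression in (i) is w11^2 times
        the quadratic evaluated at the only candidate s.\<close>
      have "w11 * (w11 * w22 - w12 * w21) - w12^2 = w11 * (w11 * (w22 - s * (w21 + s))) +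
          int p * (- d * (w11 * w21 + 2 * (w11 * s) + int p * d))"
        unfolding w12 by (simp add: power2_eq_square algebra_simps)
      then show ?thesis
        using False by (simp add: cong_iff_dvd_diff prime dvd_diff_left_iff)
    qed
    moreover have "[w12 = 0] (mod int p) \<longleftrightarrow> int p dvd s"
      using root[of 0] by simp
    moreover have "[w22 = s * (w21 + s)] (mod int p) \<longleftrightarrow> [w22 = 0] (mod int p)" if "int p dvd s"
      using at_s[of 0] that by simp
    \<comment> \<open>A root at s makes the discriminant a square, so for w11 nonzero condition
      (iii) is subsumed under (i) and (ii).\<close>
    moreover have "[w22 = s * (w21 + s)] (mod int p) \<Longrightarrow> QuadRes (int p) (w21^2 + 4 * w22)"
      unfolding disc by blast
    ultimately show ?thesis
      using False by (auto simp: cong_0_iff)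
  qed
qed

section \<open>Minimal and maximal index\<close>

lemma (in group) A1_indices_extrema:
  assumes p: "Factorial_Ring.prime p" and fin: "finite (carrier G)"
    and pow: "\<And>i. i \<in> A1_indices p G \<Longrightarrow> \<exists>s. i = p ^ s"
    and ne: "A1_indices p G \<noteq> {}"
  shows "finite (A1_indices p G)" "p ^ I_min p G = Min (A1_indices p G)"
    "p ^ I_max p G = Max (A1_indices p G)"
proof -
  have "A1_indices p G \<subseteq> (\<lambda>H. card (rcosets H)) ` Pow (carrier G)"
    by (auto simp: A1_indices_def A1_subgroup_def dest: subgroup.subset)
  then show f: "finite (A1_indices p G)"
    using fin by (meson finite_Pow_iff finite_imageI finite_subset)
  have inj: "i = j" if "p ^ i = p ^ j" for i j
    using that prime_gt_1_nat[OF p] power_inject_exp by blast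
  \<comment> \<open>The descriptions defining \<open>I_min\<close> and \<open>I_max\<close> denote
    because every index is a power of p with a unique exponent.\<close>
  have the: "p ^ (THE i. p ^ i = k) = k" if k: "k \<in> A1_indices p G" for k
  proof (rule theI')
    show "\<exists>!i. p ^ i = k"
      using pow[OF k] inj by metis
  qed
  show "p ^ I_min p G = Min (A1_indices p G)" "p ^ I_max p G = Max (A1_indices p G)"
    unfolding I_min_def I_max_def using the f ne by (simp_all add: Min_in Max_in)
qed

context metabelian_tower
begin

theorem A1_index_bounds:
  shows "2 \<le> I_min p G" "\<not> (\<exists>H. A1_subgroup p H G \<and> card (rcosets H) = p)"
    "m \<le> I_max p G"
    "I_max p G = 2 \<longleftrightarrow>
      m = 2 \<and> (\<nexists>t. [w12 = t * w11] (mod int p) \<and> [w22 = t * (w21 + t)] (mod int p))"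
proof -
  let ?A = "A1_indices p G"
  have pow: "\<exists>s\<ge>2. i = p ^ s" if "i \<in> ?A" for i
    using that A1_subgroup_index by (auto simp: A1_indices_def)
  have fin: "finite (carrier G)"
    using p_group by (simp add: finite_p_group_def)
  obtain H0 where H0: "A1_subgroup p H0 G" "p ^ m \<le> card (rcosets H0)"
    using A1_subgroup_index_ge_p_m by blast
  then have ne: "?A \<noteq> {}"
    by (auto simp: A1_indices_def)
  have mem: "card (rcosets H) \<in> ?A" if "A1_subgroup p H G" for H
    using that by (auto simp: A1_indices_def)
  note ext = A1_indices_extrema[OF p fin _ ne]
  have f: "finite ?A" and Min: "p ^ I_min p G = Min ?A" and Max: "p ^ I_max p G = Max ?A"
    using ext pow by blast+
  have le_iff: "p ^ i \<le> p ^ j \<longleftrightarrow> i \<le> j" for i j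
    using prime_gt_1_nat[OF p] by (simp add: power_increasing_iff)
  have eq_iff: "p ^ i = p ^ j \<longleftrightarrow> i = j" for i j
    using prime_gt_1_nat[OF p] by (simp add: power_inject_exp)
  have ge: "i \<le> I_max p G" if "A1_subgroup p H G" "p ^ i \<le> card (rcosets H)" for H i
  proof -
    have "p ^ i \<le> p ^ I_max p G"
      unfolding Max using that Max_ge[OF f mem] le_trans by blast
    then show ?thesis by (simp add: le_iff)
  qed
  show "2 \<le> I_min p G"
    using pow[OF Min_in[OF f ne]] unfolding Min[symmetric] eq_iff by auto
  show "\<not> (\<exists>H. A1_subgroup p H G \<and> card (rcosets H) = p)"
    using pow[OF mem] eq_iff[of 1] by fastforce
  show m: "m \<le> I_max p G"
    using ge H0 by blast
  have max2: "2 \<le> I_max p G"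
    using m m_ge_2 by simp
  show "I_max p G = 2 \<longleftrightarrow>
      m = 2 \<and> (\<nexists>t. [w12 = t * w11] (mod int p) \<and> [w22 = t * (w21 + t)] (mod int p))"
  proof
    assume two: "I_max p G = 2"
    then have "m = 2"
      using m m_ge_2 by simp
    moreover have "\<not> ([w12 = t * w11] (mod int p) \<and> [w22 = t * (w21 + t)] (mod int p))" for t
      using A1_subgroup_index_ge_p_3[OF \<open>m = 2\<close>, of t] ge[of _ 3] two by fastforce
    ultimately show "m = 2 \<and> (\<nexists>t. [w12 = t * w11] (mod int p) \<and> [w22 = t * (w21 + t)] (mod int p))"
      by blast
  next
    assume cond: "m = 2 \<and> (\<nexists>t. [w12 = t * w11] (mod int p) \<and> [w22 = t * (w21 + t)] (mod int p))"
    have "Max ?A \<in> ?A"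
      using f ne by (rule Max_in)
    then obtain H where "A1_subgroup p H G" "Max ?A = card (rcosets H)"
      by (auto simp: A1_indices_def)
    then have "p ^ I_max p G \<le> p ^ 2"
      using A1_subgroup_index_le_p_2[of H] cond Max by simp
    then show "I_max p G = 2"
      using max2 by (simp add: le_iff)
  qed
qed

end

section \<open>Central and characteristic subgroups\<close>

lemma (in group) prime_order_subgroup_cyclic:
  assumes p: "Factorial_Ring.prime p" and N: "subgroup N G" "card N = p" and u: "u \<in> N" "u \<noteq> \<one>"
  shows "N = range (\<lambda>i::int. u [^] i)" "u [^] p = \<one>"
proof -
  have uG: "u \<in> carrier G"
    using subgroup.mem_carrier[OF N(1) u(1)] .
  interpret N: group "G\<lparr>carrier := N\<rparr>"
    using N(1) by (rule subgroup_imp_group)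
  have fin: "finite N"
    using N(2) prime_gt_0_nat[OF p] card_ge_0_finite by force
  have sub: "generate G {u} \<subseteq> N"
    using u N(1) by (simp add: generate_subgroup_incl)
  have "subgroup (generate G {u}) G"
    using uG by (intro generate_is_subgroup) simp
  then have "subgroup (generate G {u}) (G\<lparr>carrier := N\<rparr>)"
    using sub N(1) by (simp add: subgroup_incl)
  then have "card (generate G {u}) dvd p"
    using N.lagrange[of "generate G {u}"] N(2) by (auto simp: order_def intro: dvdI[of _ _ "card _"] simp: mult.commute)
  moreover have "card (generate G {u}) \<noteq> 1"
  proof
    assume "card (generate G {u}) = 1"
    then obtain v where "generate G {u} = {v}"
      by (rule card_1_singletonE)
    then show False
      using u(2) generate.one[of G "{u}"] generate.incl[of u "{u}" G] by simp
  qed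
  ultimately have "card (generate G {u}) = card N"
    using p N(2) by (metis prime_nat_iff)
  then have "generate G {u} = N"
    using sub fin by (simp add: card_subset_eq)
  then show "N = range (\<lambda>i::int. u [^] i)"
    using generate_pow[OF uG] by auto
  have "u [^]\<^bsub>G\<lparr>carrier := N\<rparr>\<^esub> order (G\<lparr>carrier := N\<rparr>) = \<one>"
    using N.pow_order_eq_1[of u] u by simp
  then show "u [^] p = \<one>"
    using N(2) nat_pow_consistent[of u p N] by (simp add: order_def)
qed

text \<open>Conjugation by \<open>g\<close> acts as \<open>u \<mapsto> u\<^sup>k\<close>; then \<open>k\<close> to the power \<open>|G|\<close> is 1 modulo \<open>p\<close>, while Fermat's
  theorem reduces it to \<open>k\<close>.\<close>

lemma (in group) normal_prime_order_central:
  assumes p: "Factorial_Ring.prime p" and fin: "finite_p_group p G" and N: "N \<lhd> G" "card N = p"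
    and g: "g \<in> carrier G" and u: "u \<in> N"
  shows "g \<otimes> u = u \<otimes> g"
proof (cases "u = \<one>")
  case False
  have sub: "subgroup N G"
    using N(1) by (rule normal_imp_subgroup)
  have [simp]: "u \<in> carrier G"
    using subgroup.mem_carrier[OF sub u] .
  note cyc = prime_order_subgroup_cyclic[OF p sub N(2) u False]
  have up: "u [^] i = u [^] j" if "[i = j] (mod int p)" for i j :: int
    using int_pow_cong[OF _ cyc(2) that] by simp
  have "inv g \<otimes> u \<otimes> g \<in> N"
    using normal.inv_op_closed1[OF N(1) g u] .
  then obtain i :: int where "inv g \<otimes> u \<otimes> g = u [^] i"
    using cyc(1) by blast
  also have "\<dots> = u [^] int (nat (i mod int p))"
    using p by (intro up) (simp add: cong_def prime_gt_0_nat)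
  finally obtain k :: nat where k: "inv g \<otimes> u \<otimes> g = u [^] int k"
    by blast
  have iter: "inv (g [^] j) \<otimes> u \<otimes> g [^] j = u [^] int (k ^ j)" for j :: nat
  proof (induction j)
    case 0
    then show ?case by simp
  next
    case (Suc j)
    have "inv (g [^] Suc j) \<otimes> u \<otimes> g [^] Suc j = inv g \<otimes> (inv (g [^] j) \<otimes> u \<otimes> g [^] j) \<otimes> g"
      using g by (simp add: inv_mult_group m_assoc)
    also have "\<dots> = (inv g \<otimes> u \<otimes> g) [^] int (k ^ j)"
      unfolding Suc.IH using conj_int_pow[OF g \<open>u \<in> carrier G\<close>] by simp
    also have "\<dots> = u [^] (int k * int (k ^ j))"
      unfolding k by (rule int_pow_pow) simp
    finally show ?case by simp
  qed
  obtain r where r: "order G = p ^ r"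
    using fin by (auto simp: finite_p_group_def)
  have "u [^] int (k ^ p ^ r) = u"
    using iter[of "p ^ r"] pow_order_eq_1[OF g] g r by simp
  then have "u [^] (int (k ^ p ^ r) - 1) = \<one>"
    by (simp add: int_pow_diff)
  then have "int p dvd int (k ^ p ^ r) - 1"
    using subgroup_int_pow_cancel[OF p fin triv_subgroup, of u "int (k ^ p ^ r) - 1"] False by auto
  then have one: "[k ^ p ^ r = 1] (mod p)"
    using cong_int_iff[of "k ^ p ^ r" 1 p] by (simp add: cong_iff_dvd_diff)
  have fermat: "[k ^ p ^ s = k] (mod p)" for s
  proof (induction s)
    case (Suc s)
    have pp: "[l ^ p = l] (mod p)" for l
    proof (cases "p dvd l")
      case True
      then show ?thesis
        using p by (meson cong_0_iff cong_sym cong_trans dvd_power_le dvd_trans dvd_power prime_gt_0_nat)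
    next
      case False
      then have "[l * l ^ (p - 1) = l * 1] (mod p)"
        using fermat_theorem[OF p] cong_scalar_left by blast
      then show ?thesis
        using prime_gt_0_nat[OF p] by (simp add: power_eq_if)
    qed
    have "[(k ^ p ^ s) ^ p = k ^ p ^ s] (mod p)"
      by (rule pp)
    then show ?case
      using Suc.IH by (metis cong_trans power_Suc2 power_mult)
  qed simp
  have "[k = 1] (mod p)"
    using cong_trans[OF cong_sym[OF fermat] one] .
  then have "u [^] int k = u"
    using up[of "int k" 1] cong_int_iff[of k 1 p] by simp
  then have "inv g \<otimes> u \<otimes> g = u"
    using k by simp
  then show ?thesis
    using conj_eq_iff[of g u u] g by simp
qed (use g in simp)

section \<open>The derived subgroup, \<open>gamma3\<close> and Frattini non-generators\<close>

context group
begin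

lemma derived_subset: "derived G (carrier G) \<subseteq> carrier G"
  using derived_self_is_normal normal_imp_subgroup subgroup.subset by blast

lemma subgroup_derived_carrier: "subgroup (derived G (carrier G)) G"
  using derived_self_is_normal by (rule normal_imp_subgroup)

lemma commutator_in_derived:
  assumes "x \<in> carrier G" "z \<in> carrier G"
  shows "commutator G x z \<in> derived G (carrier G)"
proof -
  \<comment> \<open>Passing to inverses of both arguments translates between the two commutator
    conventions.\<close>
  have "commutator G x z = inv x \<otimes> inv z \<otimes> inv (inv x) \<otimes> inv (inv z)"
    using assms by (simp add: commutator_def)
  then have "commutator G x z \<in> derived_set G (carrier G)"
    using inv_closed[OF assms(1)] inv_closed[OF assms(2)] by blast
  then show ?thesis
    unfolding derived_def by (rule generate.incl)
qed

lemma commutator_conj: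
  assumes "g \<in> carrier G" "x \<in> carrier G" "z \<in> carrier G"
  shows "g \<otimes> commutator G x z \<otimes> inv g = commutator G (g \<otimes> x \<otimes> inv g) (g \<otimes> z \<otimes> inv g)"
  using assms by (simp add: commutator_def inv_mult_group m_assoc)

lemma gamma3_subset_derived: "gamma3 G \<subseteq> derived G (carrier G)"
  unfolding gamma3_def
  using commutator_in_derived derived_subset
  by (intro generate_subgroup_incl[OF _ subgroup_derived_carrier]) auto

lemma gamma3_normal: "gamma3 G \<lhd> G"
  unfolding gamma3_def
proof (rule normal_generateI)
  show "{commutator G x y |x y. x \<in> derived G (carrier G) \<and> y \<in> carrier G} \<subseteq> carrier G"
    using derived_subset by auto
next
  fix h g
  assume "h \<in> {commutator G x y |x y. x \<in> derived G (carrier G) \<and> y \<in> carrier G}" and g: "g \<in> carrier G"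
  then obtain x z where xz: "x \<in> derived G (carrier G)" "z \<in> carrier G" "h = commutator G x z"
    by blast
  moreover have "g \<otimes> x \<otimes> inv g \<in> derived G (carrier G)"
    using normal.inv_op_closed2[OF derived_self_is_normal g xz(1)] .
  moreover have "g \<otimes> z \<otimes> inv g \<in> carrier G"
    using g xz by simp
  moreover have "g \<otimes> h \<otimes> inv g = commutator G (g \<otimes> x \<otimes> inv g) (g \<otimes> z \<otimes> inv g)"
    using commutator_conj[of g x z] g xz derived_subset by auto
  ultimately show "g \<otimes> h \<otimes> inv g \<in> {commutator G x y |x y. x \<in> derived G (carrier G) \<and> y \<in> carrier G}"
    by blast
qed

lemma commutator_in_gamma3:
  "x \<in> derived G (carrier G) \<Longrightarrow> z \<in> carrier G \<Longrightarrow> commutator G x z \<in> gamma3 G"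
  unfolding gamma3_def by (rule generate.incl) blast

lemma subgroup_frattini: "subgroup (frattini G) G"
proof -
  have "frattini G = \<Inter>(insert (carrier G) {M. maximal_subgroup M G})"
    by (simp add: frattini_def)
  then show ?thesis
    using subgroups_Inter[of "insert (carrier G) {M. maximal_subgroup M G}"] subgroup_self
    by (auto simp: maximal_subgroup_def)
qed

lemma frattini_derived_subgroup:
  "subgroup (frattini (G\<lparr>carrier := derived G (carrier G)\<rparr>)) G"
  "frattini (G\<lparr>carrier := derived G (carrier G)\<rparr>) \<subseteq> derived G (carrier G)"
proof -
  interpret D: group "G\<lparr>carrier := derived G (carrier G)\<rparr>"
    using subgroup_derived_carrier by (rule subgroup_imp_group)
  show "subgroup (frattini (G\<lparr>carrier := derived G (carrier G)\<rparr>)) G"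
    by (rule incl_subgroup[OF subgroup_derived_carrier D.subgroup_frattini])
  show "frattini (G\<lparr>carrier := derived G (carrier G)\<rparr>) \<subseteq> derived G (carrier G)"
    by (simp add: frattini_def)
qed

lemma gamma3_subset_frattini_gamma3: "gamma3 G \<subseteq> frattini_gamma3 G"
proof
  fix g assume g: "g \<in> gamma3 G"
  then have "g \<in> carrier G"
    using gamma3_subset_derived derived_subset by blast
  then have "g = \<one> \<otimes> g" by simp
  then show "g \<in> frattini_gamma3 G"
    unfolding frattini_gamma3_def set_mult_def
    using g subgroup.one_closed[OF frattini_derived_subgroup(1)] by blast
qed

lemma frattini_gamma3_subset_derived: "frattini_gamma3 G \<subseteq> derived G (carrier G)"
  unfolding frattini_gamma3_def set_mult_def
  using frattini_derived_subgroup(2) gamma3_subset_derived subgroup.m_closed[OF subgroup_derived_carrier]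
  by blast

text \<open>Elements of the subgroup lie in G', so conjugation changes them by a factor in
  \<open>gamma3 G\<close>, which the subgroup contains. This avoids showing that the Frattini
  subgroup of G' is characteristic.\<close>

lemma frattini_gamma3_normal: "frattini_gamma3 G \<lhd> G"
  unfolding normal_inv_iff
proof (intro conjI ballI)
  show sub: "subgroup (frattini_gamma3 G) G"
    unfolding frattini_gamma3_def commut_normal[OF frattini_derived_subgroup(1) gamma3_normal]
    using mult_norm_subgroup[OF gamma3_normal frattini_derived_subgroup(1)] .
  fix g h assume g: "g \<in> carrier G" and h: "h \<in> frattini_gamma3 G"
  then have hG: "h \<in> carrier G" "h \<in> derived G (carrier G)"
    using frattini_gamma3_subset_derived derived_subset by auto
  have "g \<otimes> h \<otimes> inv g = h \<otimes> commutator G h (inv g)"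
    using g hG by (simp add: commutator_def m_assoc)
  also have "\<dots> \<in> frattini_gamma3 G"
    using h g hG commutator_in_gamma3 gamma3_subset_frattini_gamma3
    by (intro subgroup.m_closed[OF sub]) auto
  finally show "g \<otimes> h \<otimes> inv g \<in> frattini_gamma3 G" .
qed

text \<open>If \<open>M0\<close> were proper, some maximal subgroup of G' would contain it. That
  subgroup contains the Frattini subgroup of G' and, through \<open>M0\<close>, also
  \<open>gamma3 G\<close>, hence all of G'.\<close>

lemma derived_nongenerators:
  assumes fin: "finite (carrier G)" and M0: "subgroup M0 G" "gamma3 G \<subseteq> M0" "M0 \<subseteq> derived G (carrier G)"
    and gen: "\<And>d. d \<in> derived G (carrier G) \<Longrightarrow> \<exists>h\<in>M0. \<exists>\<kappa>\<in>frattini_gamma3 G. d = h \<otimes> \<kappa>"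
  shows "M0 = derived G (carrier G)"
proof (rule ccontr)
  let ?D = "derived G (carrier G)"
  assume ne: "M0 \<noteq> ?D"
  have finD: "finite ?D"
    using fin derived_subset by (rule finite_subset[rotated])
  define S where "S = {M. subgroup M G \<and> M0 \<subseteq> M \<and> M \<subset> ?D}"
  have "finite S"
    by (rule finite_subset[of _ "Pow ?D"]) (use finD in \<open>auto simp: S_def\<close>)
  moreover have "M0 \<in> S"
    using M0 ne by (auto simp: S_def)
  ultimately obtain M where M: "M \<in> S" and max: "\<And>M'. M' \<in> S \<Longrightarrow> M \<subseteq> M' \<Longrightarrow> M = M'"
    using finite_has_maximal[of S] by blast
  have MG: "subgroup M G" "M0 \<subseteq> M" "M \<subset> ?D"
    using M by (auto simp: S_def)
  have "maximal_subgroup M (G\<lparr>carrier := ?D\<rparr>)"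
    unfolding maximal_subgroup_def
  proof (intro conjI allI impI)
    show "subgroup M (G\<lparr>carrier := ?D\<rparr>)"
      using MG subgroup_derived_carrier by (intro subgroup_incl) auto
    show "M \<noteq> carrier (G\<lparr>carrier := ?D\<rparr>)"
      using MG by auto
    fix H assume H: "subgroup H (G\<lparr>carrier := ?D\<rparr>)" "M \<subseteq> H"
    then have "subgroup H G" "H \<subseteq> ?D"
      using incl_subgroup[OF subgroup_derived_carrier] subgroup.subset[OF H(1)] by auto
    then show "H = M \<or> H = carrier (G\<lparr>carrier := ?D\<rparr>)"
      using max[of H] H MG by (auto simp: S_def)
  qed
  then have "frattini (G\<lparr>carrier := ?D\<rparr>) \<subseteq> M"
    by (auto simp: frattini_def)
  then have "frattini_gamma3 G \<subseteq> M"
    unfolding frattini_gamma3_def set_mult_def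
    using M0(2) MG(2) subgroup.m_closed[OF MG(1)] by blast
  then have "?D \<subseteq> M"
    using gen MG subgroup.m_closed[OF MG(1)] by blast
  then show False
    using MG by blast
qed

end

lemma iso_exponent:
  assumes "G \<cong> H" "group G" "group H" and exp: "\<And>h. h \<in> carrier H \<Longrightarrow> h [^]\<^bsub>H\<^esub> (r::nat) = \<one>\<^bsub>H\<^esub>"
    and g: "g \<in> carrier G"
  shows "g [^]\<^bsub>G\<^esub> r = \<one>\<^bsub>G\<^esub>"
proof -
  obtain f where f: "f \<in> hom G H" "bij_betw f (carrier G) (carrier H)"
    using assms(1) by (auto simp: is_iso_def iso_def)
  interpret group_hom G H f
    using assms f by (simp add: group_hom_def group_hom_axioms_def)
  have "f (g [^]\<^bsub>G\<^esub> r) = f \<one>\<^bsub>G\<^esub>"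
    using exp[of "f g"] g by (simp add: hom_nat_pow)
  then show ?thesis
    using f(2) g by (meson G.nat_pow_closed G.one_closed bij_betw_def inj_onD)
qed

lemma DirProd_nat_pow:
  "(g, h) [^]\<^bsub>G \<times>\<times> H\<^esub> (r::nat) = (g [^]\<^bsub>G\<^esub> r, h [^]\<^bsub>H\<^esub> r)"
  by (induction r) simp_all

lemma integer_mod_group_exponent: "n dvd r \<Longrightarrow> g [^]\<^bsub>integer_mod_group n\<^esub> (r::nat) = \<one>\<^bsub>integer_mod_group n\<^esub>"
  by (auto simp: mod_mult_left_eq)

lemma card_integer_mod_group: "0 < n \<Longrightarrow> card (carrier (integer_mod_group n)) = n"
  by (simp add: carrier_integer_mod_group)

section \<open>From the hypotheses to the normal form\<close>

lemma (in group) inv_mult_one_iff: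
  "x \<in> carrier G \<Longrightarrow> z \<in> carrier G \<Longrightarrow> inv x \<otimes> z = \<one> \<longleftrightarrow> z = x"
  by (metis inv_closed inv_cancel_left(2) l_inv r_one)

lemma (in group_hom) commutator_hom:
  "x \<in> carrier G \<Longrightarrow> z \<in> carrier G \<Longrightarrow> commutator H (h x) (h z) = h (commutator G x z)"
  by (simp add: commutator_def)

locale char_generated = group +
  fixes p n m :: nat and a b
  assumes p: "Factorial_Ring.prime p" and odd_p: "odd p" and p_group: "finite_p_group p G"
    and gamma3_iso: "(G\<lparr>carrier := gamma3 G\<rparr>) \<cong> integer_mod_group p"
    and K_iso: "(G\<lparr>carrier := frattini_gamma3 G\<rparr>) \<cong> (integer_mod_group p \<times>\<times> integer_mod_group p)"
    and centralizer_iso: "(G\<lparr>carrier := centralizer G (derived_subgroup G)\<rparr> Mod frattini_gamma3 G) \<cong>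
      (integer_mod_group (p ^ (n - 1)) \<times>\<times> integer_mod_group (p ^ m) \<times>\<times> integer_mod_group p)"
    and m_less_n: "m < n" and gens: "char_generators p n m G a b"
begin

abbreviation D where "D \<equiv> derived_subgroup G"
abbreviation Z where "Z \<equiv> gamma3 G"
abbreviation K where "K \<equiv> frattini_gamma3 G"
abbreviation C where "C \<equiv> centralizer G D"
abbreviation c where "c \<equiv> commutator G a b"
abbreviation y where "y \<equiv> commutator G a c"
abbreviation Q where "Q \<equiv> G Mod K"
abbreviation \<pi> where "\<pi> g \<equiv> K #> g"

lemma a [simp]: "a \<in> carrier G" and b [simp]: "b \<in> carrier G"
  using gens by (auto simp: char_generators_def)

lemma fin: "finite (carrier G)"
  using p_group by (simp add: finite_p_group_def)

lemma p_pos: "0 < p"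
  using p by (rule prime_gt_0_nat)

lemma card_Z: "card Z = p"
  using iso_same_card[OF gamma3_iso] card_integer_mod_group[OF p_pos] by simp

lemma card_K: "card K = p * p"
  using iso_same_card[OF K_iso] card_integer_mod_group[OF p_pos]
  by (simp add: card_cartesian_product)

lemma subgroup_K: "subgroup K G" and subgroup_Z: "subgroup Z G"
  using frattini_gamma3_normal gamma3_normal by (simp_all add: normal_imp_subgroup)

lemma K_exponent: "g \<in> K \<Longrightarrow> g [^] p = \<one>"
  using iso_exponent[OF K_iso subgroup_imp_group[OF subgroup_K], of p g] nat_pow_consistent[of g p K]
  by (auto simp: DirProd_group DirProd_nat_pow)

lemma Z_central: "g \<in> carrier G \<Longrightarrow> z \<in> Z \<Longrightarrow> g \<otimes> z = z \<otimes> g"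
  by (rule normal_prime_order_central[OF p p_group gamma3_normal card_Z])

lemma hom_\<pi>: "group_hom G Q \<pi>"
  using normal.r_coset_hom_Mod[OF frattini_gamma3_normal] normal.factorgroup_is_group[OF frattini_gamma3_normal]
  by (simp add: group_hom_def group_hom_axioms_def is_group)

sublocale \<pi>: group_hom G Q \<pi>
  by (rule hom_\<pi>)

lemma \<pi>_one_iff: "g \<in> carrier G \<Longrightarrow> \<pi> g = \<one>\<^bsub>Q\<^esub> \<longleftrightarrow> g \<in> K"
  using coset_join1[OF _ _ subgroup_K] coset_join2[OF _ subgroup_K] by auto

lemma \<pi>_eq_iff:
  assumes "g \<in> carrier G" "h \<in> carrier G"
  shows "\<pi> g = \<pi> h \<longleftrightarrow> inv h \<otimes> g \<in> K"
proof -
  have "\<pi> (inv h \<otimes> g) = inv\<^bsub>Q\<^esub> \<pi> h \<otimes>\<^bsub>Q\<^esub> \<pi> g"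
    using assms by (simp del: mult_FactGroup)
  then show ?thesis
    using \<pi>.H.inv_mult_one_iff[OF \<pi>.hom_closed[OF assms(2)] \<pi>.hom_closed[OF assms(1)]]
      \<pi>_one_iff[of "inv h \<otimes> g"] assms by simp
qed

lemma ord_\<pi>: "group.ord Q (\<pi> a) = p ^ n" "group.ord Q (\<pi> b) = p ^ m"
  and \<pi>_generate: "generate Q {\<pi> a, \<pi> b} = carrier Q"
  using gens by (simp_all add: char_generators_def Let_def)

lemma \<pi>_c: "commutator Q (\<pi> a) (\<pi> b) = \<pi> c"
  by (rule \<pi>.commutator_hom) simp_all

lemma c_pow_p: "c [^] p \<in> K"
proof -
  have "\<pi> c [^]\<^bsub>Q\<^esub> p = \<one>\<^bsub>Q\<^esub>"
    using gens by (simp add: char_generators_def Let_def \<pi>_c)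
  then show ?thesis
    using \<pi>_one_iff[of "c [^] p"] by (simp add: \<pi>.hom_nat_pow)
qed

lemma triple_\<pi>: "heisenberg_triple Q (\<pi> a) (\<pi> b) (\<pi> c)"
proof (rule \<pi>.H.heisenberg_tripleI)
  have "commutator Q (\<pi> c) (\<pi> a) = \<one>\<^bsub>Q\<^esub>" "commutator Q (\<pi> c) (\<pi> b) = \<one>\<^bsub>Q\<^esub>"
    using gens by (simp_all add: char_generators_def Let_def \<pi>_c)
  then show "\<pi> a \<otimes>\<^bsub>Q\<^esub> \<pi> c = \<pi> c \<otimes>\<^bsub>Q\<^esub> \<pi> a" "\<pi> b \<otimes>\<^bsub>Q\<^esub> \<pi> c = \<pi> c \<otimes>\<^bsub>Q\<^esub> \<pi> b"
    using \<pi>.H.commutator_one_iff[of "\<pi> c"] \<pi>.hom_closed by (metis a b commutator_closed)+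
qed (simp_all add: \<pi>_c del: mult_FactGroup)

sublocale Q: heisenberg_triple Q "\<pi> a" "\<pi> b" "\<pi> c"
  by (rule triple_\<pi>)

lemma W_\<pi>: "Q.W i j k = \<pi> (a [^] i \<otimes> b [^] j \<otimes> c [^] k)"
  by (simp add: Q.W_def \<pi>.hom_int_pow \<pi>.hom_mult del: mult_FactGroup)

lemma \<pi>_W:
  assumes "g \<in> carrier G"
  shows "\<exists>i j k. \<pi> g = Q.W i j k"
  using Q.generate_subset_W \<pi>.hom_closed[OF assms] unfolding \<pi>_generate by blast

lemma mod_K:
  assumes "g \<in> carrier G"
  shows "\<exists>(i::int) (j::int) (k::int). \<exists>\<kappa>\<in>K. g = a [^] i \<otimes> b [^] j \<otimes> c [^] k \<otimes> \<kappa>"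
proof -
  obtain i j k :: int where *: "\<pi> g = \<pi> (a [^] i \<otimes> b [^] j \<otimes> c [^] k)"
    using \<pi>_W[OF assms] unfolding W_\<pi> by blast
  have "inv (a [^] i \<otimes> b [^] j \<otimes> c [^] k) \<otimes> g \<in> K"
    by (rule \<pi>_eq_iff[THEN iffD1, OF assms _ *]) simp
  moreover have "g = (a [^] i \<otimes> b [^] j \<otimes> c [^] k) \<otimes> (inv (a [^] i \<otimes> b [^] j \<otimes> c [^] k) \<otimes> g)"
    using assms by (simp del: m_assoc)
  ultimately show ?thesis by blast
qed

lemma Z_subset: "Z \<subseteq> carrier G"
  using subgroup.subset[OF subgroup_Z] .

lemma c_in_D: "c \<in> D"
  by (rule commutator_in_derived) simp_all

text \<open>By \<open>Q.commutator_W\<close> every commutator of the quotient is a power of the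
  image of \<open>c\<close>, so the preimage of that cyclic group contains G'.\<close>

lemma D_mod_K:
  assumes "d \<in> D"
  shows "\<exists>k::int. \<exists>\<kappa>\<in>K. d = c [^] k \<otimes> \<kappa>"
proof -
  let ?S = "{g \<in> carrier G. \<exists>k::int. \<pi> g = Q.W 0 0 k}"
  have "subgroup ?S G"
  proof (rule subgroupI)
    show "?S \<noteq> {}"
      using Q.W_0 by (auto intro!: exI[of _ \<one>] exI[of _ 0] simp: \<pi>.hom_one)
  next
    fix g assume "g \<in> ?S"
    then show "inv g \<in> ?S"
      using Q.inv_W[of 0 0] by (auto simp: \<pi>.hom_inv)
  next
    fix g h assume "g \<in> ?S" "h \<in> ?S"
    then show "g \<otimes> h \<in> ?S"
      using Q.W_mult[of 0 0 _ 0 0] by (auto simp: \<pi>.hom_mult simp del: mult_FactGroup)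
  qed auto
  moreover have "derived_set G (carrier G) \<subseteq> ?S"
  proof
    fix g assume "g \<in> derived_set G (carrier G)"
    then obtain h1 h2 where h: "h1 \<in> carrier G" "h2 \<in> carrier G" "g = h1 \<otimes> h2 \<otimes> inv h1 \<otimes> inv h2"
      by blast
    then have g: "g = commutator G (inv h1) (inv h2)"
      by (simp add: commutator_def)
    obtain i j k i' j' k' where "\<pi> (inv h1) = Q.W i j k" "\<pi> (inv h2) = Q.W i' j' k'"
      using \<pi>_W[OF inv_closed[OF h(1)]] \<pi>_W[OF inv_closed[OF h(2)]] by blast
    moreover have "\<pi> g = commutator Q (\<pi> (inv h1)) (\<pi> (inv h2))"
      unfolding g using h by (intro \<pi>.commutator_hom[symmetric]) simp_all
    ultimately have "\<pi> g = Q.W 0 0 (i * j' - i' * j)"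
      by (simp only: Q.commutator_W)
    then show "g \<in> ?S"
      using h g by auto
  qed
  ultimately have "D \<subseteq> ?S"
    unfolding derived_def by (rule generate_subgroup_incl[rotated])
  then obtain k :: int where "\<pi> d = Q.W 0 0 k" and d: "d \<in> carrier G"
    using assms by blast
  then have k: "\<pi> d = \<pi> (c [^] k)"
    using W_\<pi>[of 0 0 k] by simp
  then have "inv (c [^] k) \<otimes> d \<in> K"
    using \<pi>_eq_iff[OF d, of "c [^] k"] by simp
  moreover have "d = c [^] k \<otimes> (inv (c [^] k) \<otimes> d)"
    using d by simp
  ultimately show ?thesis by blast
qed

text \<open>Otherwise G' lies in \<open>K\<close>, non-generation gives G' = \<open>Z\<close>, and
  then \<open>K\<close> = \<open>Z\<close>, although the orders are p^2 and p.\<close>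

lemma c_notin_K: "c \<notin> K"
proof
  assume "c \<in> K"
  then have DK: "d \<in> K" if "d \<in> D" for d
    using D_mod_K[OF that] subgroup.m_closed[OF subgroup_K] subgroup_int_pow_closed[OF subgroup_K] by blast
  have "Z = D"
  proof (rule derived_nongenerators[OF fin subgroup_Z subset_refl gamma3_subset_derived])
    fix d assume d: "d \<in> D"
    then have "d = \<one> \<otimes> d"
      using derived_subset by auto
    then show "\<exists>h\<in>Z. \<exists>\<kappa>\<in>K. d = h \<otimes> \<kappa>"
      using DK[OF d] subgroup.one_closed[OF subgroup_Z] by blast
  qed
  then have "K = Z"
    using frattini_gamma3_subset_derived gamma3_subset_frattini_gamma3 by blast
  then show False
    using card_K card_Z prime_gt_1_nat[OF p] by simp
qed

text \<open>The subgroup generated by \<open>c\<close> and \<open>Z\<close> covers G' modulo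
  \<open>K\<close>, and \<open>K\<close> consists of non-generators modulo \<open>Z\<close>.\<close>

lemma D_mod_Z:
  assumes "d \<in> D"
  shows "\<exists>k::int. \<exists>u\<in>Z. d = c [^] k \<otimes> u"
proof -
  let ?M = "{c [^] (k::int) \<otimes> u | k u. u \<in> Z}"
  have Zc: "u \<in> carrier G" "u \<otimes> c [^] (k::int) = c [^] k \<otimes> u" if "u \<in> Z" for u k
    using that Z_subset Z_central[of "c [^] k" u] by auto
  have mult: "(c [^] k \<otimes> u) \<otimes> (c [^] l \<otimes> v) = c [^] (k + l) \<otimes> (u \<otimes> v)" if "u \<in> Z" "v \<in> Z" for k l :: int and u v
  proof -
    have "(c [^] k \<otimes> u) \<otimes> (c [^] l \<otimes> v) = c [^] k \<otimes> (u \<otimes> c [^] l) \<otimes> v"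
      using Zc(1)[OF that(1)] Zc(1)[OF that(2)] by (simp add: m_assoc)
    also have "\<dots> = c [^] (k + l) \<otimes> (u \<otimes> v)"
      unfolding Zc(2)[OF that(1)] using Zc(1)[OF that(1)] Zc(1)[OF that(2)]
      by (simp add: m_assoc int_pow_mult)
    finally show ?thesis .
  qed
  have "subgroup ?M G"
  proof (rule subgroupI)
    show "?M \<subseteq> carrier G" using Zc by auto
    show "?M \<noteq> {}" using subgroup.one_closed[OF subgroup_Z] by auto
  next
    fix g assume "g \<in> ?M"
    then obtain k :: int and u where g: "g = c [^] k \<otimes> u" "u \<in> Z" by blast
    then have iu: "inv u \<in> Z"
      using subgroup.m_inv_closed[OF subgroup_Z] by blast
    have "(c [^] (-k) \<otimes> inv u) \<otimes> (c [^] k \<otimes> u) = \<one>"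
      using mult[OF iu g(2), of "-k" k] g Zc by simp
    then have "inv g = c [^] (-k) \<otimes> inv u"
      using g iu Zc by (intro inv_equality) auto
    then show "inv g \<in> ?M"
      using iu by blast
  next
    fix g h assume "g \<in> ?M" "h \<in> ?M"
    then obtain k l :: int and u v where gh: "g = c [^] k \<otimes> u" "u \<in> Z" "h = c [^] l \<otimes> v" "v \<in> Z"
      by blast
    then show "g \<otimes> h \<in> ?M"
      using mult[of u v k l] subgroup.m_closed[OF subgroup_Z, of u v] by auto
  qed
  moreover have "Z \<subseteq> ?M"
  proof
    fix u assume "u \<in> Z"
    moreover from this have "u = c [^] (0::int) \<otimes> u"
      using Zc by simp
    ultimately show "u \<in> ?M" by blast
  qed
  moreover have "?M \<subseteq> D"
  proof
    fix g assume "g \<in> ?M"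
    then obtain k :: int and u where "g = c [^] k \<otimes> u" "u \<in> Z" by blast
    then show "g \<in> D"
      using subgroup.m_closed[OF subgroup_derived_carrier] gamma3_subset_derived
        subgroup_int_pow_closed[OF subgroup_derived_carrier c_in_D] by auto
  qed
  moreover have "\<exists>h\<in>?M. \<exists>\<kappa>\<in>K. d = h \<otimes> \<kappa>" if dD: "d \<in> D" for d
  proof -
    obtain k :: int and \<kappa> where d: "\<kappa> \<in> K" "d = c [^] k \<otimes> \<kappa>"
      using D_mod_K[OF dD] by blast
    have "c [^] k \<otimes> \<one> \<in> ?M"
      using subgroup.one_closed[OF subgroup_Z] by blast
    then show ?thesis
      using d by (intro bexI[of _ "c [^] k"] bexI[of _ \<kappa>]) auto
  qed
  ultimately have "?M = D"
    by (rule derived_nongenerators[OF fin])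
  then show ?thesis
    using assms by blast
qed

end

section \<open>The centralizer of G' and the relations among \<open>a\<close>, \<open>b\<close>,
  \<open>c\<close>, \<open>y\<close>\<close>

context char_generated
begin

text \<open>Otherwise G' has at most p * p elements and therefore coincides with \<open>K\<close>,
  which does not contain \<open>c\<close>.\<close>

lemma c_pow_p_notin_Z: "c [^] p \<notin> Z"
proof
  assume cp: "c [^] p \<in> Z"
  have "D \<subseteq> (\<lambda>(k, u). c [^] k \<otimes> u) ` ({0..<int p} \<times> Z)"
  proof
    fix d assume "d \<in> D"
    then obtain k :: int and u where d: "u \<in> Z" "d = c [^] k \<otimes> u"
      using D_mod_Z by blast
    let ?v = "(c [^] p) [^] (k div int p)"
    have v: "?v \<in> Z"
      using subgroup_int_pow_closed[OF subgroup_Z cp] .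
    have "c [^] k = c [^] (k mod int p + int p * (k div int p))"
      by (simp only: mod_mult_div_eq)
    also have "\<dots> = c [^] (k mod int p) \<otimes> (c [^] int p) [^] (k div int p)"
      by (subst int_pow_mult) (simp_all add: int_pow_pow)
    finally have "d = c [^] (k mod int p) \<otimes> (?v \<otimes> u)"
      using d v Z_subset by (simp add: int_pow_int m_assoc subsetD)
    moreover have "?v \<otimes> u \<in> Z"
      using subgroup.m_closed[OF subgroup_Z v d(1)] .
    moreover have "k mod int p \<in> {0..<int p}"
      using p_pos by simp
    ultimately show "d \<in> (\<lambda>(k, u). c [^] k \<otimes> u) ` ({0..<int p} \<times> Z)"
      by (intro image_eqI[of _ _ "(k mod int p, ?v \<otimes> u)"]) simp_all
  qed
  moreover have finZ: "finite ({0..<int p} \<times> Z)"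
    using finite_subset[OF Z_subset fin] by simp
  ultimately have "card D \<le> card ({0..<int p} \<times> Z)"
    by (meson card_image_le card_mono finite_imageI le_trans)
  then have "card D \<le> card K"
    by (simp add: card_cartesian_product card_Z card_K)
  then have "K = D"
    using card_seteq[OF finite_subset[OF derived_subset fin] frattini_gamma3_subset_derived] by blast
  then show False
    using c_in_D c_notin_K by simp
qed

text \<open>G' consists of powers of \<open>c\<close> times elements of \<open>Z\<close>, and
  \<open>Z\<close> is central.\<close>

lemma mem_C_iff: "g \<in> C \<longleftrightarrow> g \<in> carrier G \<and> g \<otimes> c = c \<otimes> g"
proof (intro iffI conjI)
  assume g: "g \<in> carrier G \<and> g \<otimes> c = c \<otimes> g"
  have "g \<otimes> d = d \<otimes> g" if dD: "d \<in> D" for d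
  proof -
    obtain k :: int and u where d: "u \<in> Z" "d = c [^] k \<otimes> u"
      using D_mod_Z[OF dD] by blast
    have u: "u \<in> carrier G"
      using d(1) Z_subset by blast
    have "c [^] k \<otimes> g = g \<otimes> c [^] k"
      using int_pow_comm[of c g k] g by simp
    then have "g \<otimes> (c [^] k \<otimes> u) = c [^] k \<otimes> (g \<otimes> u)"
      using g u by (simp add: m_assoc[symmetric])
    then show ?thesis
      using Z_central[OF _ d(1), of g] g u by (simp add: d(2) m_assoc)
  qed
  then show "g \<in> C"
    using g by (simp add: centralizer_def)
qed (auto simp: centralizer_def c_in_D)

lemma subgroup_C: "subgroup C G"
proof (rule subgroupI)
  show "C \<subseteq> carrier G" by (auto simp: mem_C_iff)
  have "\<one> \<in> C" by (simp add: mem_C_iff)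
  then show "C \<noteq> {}" by blast
next
  fix g assume g: "g \<in> C"
  then show "inv g \<in> C"
    using int_pow_comm[of g c "-1"] by (simp add: mem_C_iff int_pow_neg)
next
  fix g h assume "g \<in> C" "h \<in> C"
  then have gh: "g \<in> carrier G" "g \<otimes> c = c \<otimes> g" "h \<in> carrier G" "h \<otimes> c = c \<otimes> h"
    by (simp_all add: mem_C_iff)
  have "g \<otimes> h \<otimes> c = g \<otimes> c \<otimes> h"
    using gh(1,3,4) by (simp add: m_assoc)
  also have "\<dots> = c \<otimes> (g \<otimes> h)"
    unfolding gh(2) using gh(1,3) by (simp add: m_assoc)
  finally show "g \<otimes> h \<in> C"
    using gh by (simp add: mem_C_iff)
qed

lemma K_subset_C: "K \<subseteq> C"
proof
  fix \<kappa> assume "\<kappa> \<in> K"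
  then obtain k :: int and u where d: "u \<in> Z" "\<kappa> = c [^] k \<otimes> u"
    using frattini_gamma3_subset_derived D_mod_Z by blast
  have "u \<in> C"
    using Z_central[OF _ d(1), of c] d(1) Z_subset by (auto simp: mem_C_iff)
  moreover have "c [^] k \<in> C"
    using int_pow_comm[of c c k] by (simp add: mem_C_iff)
  ultimately show "\<kappa> \<in> C"
    unfolding d(2) by (rule subgroup.m_closed[OF subgroup_C, rotated])
qed

lemma m_pos: "0 < m"
proof (rule ccontr)
  assume "\<not> 0 < m"
  then have "group.ord Q (\<pi> b) = 1"
    using ord_\<pi>(2) by simp
  then have "\<pi> b = \<one>\<^bsub>Q\<^esub>"
    using \<pi>.H.ord_eq_1[OF \<pi>.hom_closed[OF b]] by blast
  then have "commutator Q (\<pi> a) (\<pi> b) = \<one>\<^bsub>Q\<^esub>"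
    using \<pi>.H.commutator_one_iff[of "\<pi> a" "\<pi> b"] \<pi>.hom_closed a b by (metis \<pi>.H.l_one \<pi>.H.r_one)
  then have "c \<in> K"
    using \<pi>_one_iff[of c] \<pi>_c by simp
  then show False
    using c_notin_K by simp
qed

lemma K_normal_C: "K \<lhd> (G\<lparr>carrier := C\<rparr>)"
  by (rule normal_restrict_supergroup[OF subgroup_C frattini_gamma3_normal K_subset_C])

lemma card_C: "card C = p ^ (n + m + 2)"
proof -
  interpret C: group "G\<lparr>carrier := C\<rparr>"
    using subgroup_C by (rule subgroup_imp_group)
  have pow: "p ^ (n - 1) > 0" "p ^ m > 0"
    using p_pos by simp_all
  have "card (rcosets\<^bsub>G\<lparr>carrier := C\<rparr>\<^esub> K) = p ^ (n - 1) * (p ^ m * p)"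
    using iso_same_card[OF centralizer_iso] card_integer_mod_group[OF p_pos]
      card_integer_mod_group[OF pow(1)] card_integer_mod_group[OF pow(2)]
    by (simp add: card_cartesian_product FactGroup_def)
  moreover have "card (rcosets\<^bsub>G\<lparr>carrier := C\<rparr>\<^esub> K) * card K = card C"
    using C.lagrange[OF normal_imp_subgroup[OF K_normal_C]] by (simp add: order_def)
  moreover have "p ^ (n - 1) * (p ^ m * p) * (p * p) = p ^ (n - 1 + m + 3)"
    by (simp add: power_add power3_eq_cube mult_ac)
  moreover have "n - 1 + m + 3 = n + m + 2"
    using m_less_n by simp
  ultimately show ?thesis
    using card_K by metis
qed

text \<open>Since 0 < m < n, the largest factor in the type (p^(n-1), p^m, p) is the first, so the
  quotient of \<open>C\<close> by \<open>K\<close> has exponent p^(n-1).\<close>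

lemma C_exponent:
  assumes g: "g \<in> C"
  shows "g [^] (p ^ (n - 1)) \<in> K"
proof -
  let ?GC = "G\<lparr>carrier := C\<rparr>"
  let ?P = "integer_mod_group (p ^ (n - 1)) \<times>\<times> integer_mod_group (p ^ m) \<times>\<times> integer_mod_group p"
  interpret N: normal K ?GC
    by (rule K_normal_C)
  have gG: "g \<in> carrier G"
    using g by (simp add: mem_C_iff)
  have dvd: "p ^ m dvd p ^ (n - 1)" "p dvd p ^ (n - 1)"
    using m_less_n m_pos by (auto simp: le_imp_power_dvd intro: dvd_power)
  have "h [^]\<^bsub>?P\<^esub> (p ^ (n - 1)) = \<one>\<^bsub>?P\<^esub>" for h
    using integer_mod_group_exponent[OF dvd_refl] integer_mod_group_exponent[OF dvd(1)]
      integer_mod_group_exponent[OF dvd(2)]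
    by (cases h) (simp only: DirProd_nat_pow one_DirProd)
  moreover have "group ?P"
    by (simp add: DirProd_group)
  moreover have "K #>\<^bsub>?GC\<^esub> g \<in> carrier (?GC Mod K)"
    using g by (auto simp: FactGroup_def RCOSETS_def)
  ultimately have "(K #>\<^bsub>?GC\<^esub> g) [^]\<^bsub>?GC Mod K\<^esub> (p ^ (n - 1)) = \<one>\<^bsub>?GC Mod K\<^esub>"
    using iso_exponent[OF centralizer_iso N.factorgroup_is_group] by blast
  then have "K #>\<^bsub>?GC\<^esub> (g [^]\<^bsub>?GC\<^esub> (p ^ (n - 1))) = K"
    using N.FactGroup_pow[of g "p ^ (n - 1)"] g by simp
  then have "K #> (g [^] (p ^ (n - 1))) = K"
    using nat_pow_consistent[of g "p ^ (n - 1)" C] by (simp add: r_coset_def)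
  then show ?thesis
    using coset_join1[OF _ _ subgroup_K] gG by simp
qed

text \<open>The image of \<open>a\<close> has order p^n, more than the exponent of \<open>C\<close>
  modulo \<open>K\<close>. This is the source of [a, c] being nontrivial.\<close>

lemma a_notin_C: "a \<notin> C"
proof
  assume "a \<in> C"
  then have "\<pi> a [^]\<^bsub>Q\<^esub> (p ^ (n - 1)) = \<one>\<^bsub>Q\<^esub>"
    using C_exponent[of a] \<pi>_one_iff[of "a [^] (p ^ (n - 1))"] by (simp add: \<pi>.hom_nat_pow)
  then have "p ^ n dvd p ^ (n - 1)"
    using \<pi>.H.pow_eq_id[OF \<pi>.hom_closed[OF a]] ord_\<pi>(1) by simp
  then have "n \<le> n - 1"
    using p prime_gt_1_nat[OF p] by (simp add: dvd_power_iff_le)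
  then show False
    using m_less_n by simp
qed

lemma commutator_c_in_Z:
  assumes g: "g \<in> carrier G"
  shows "commutator G g c \<in> Z"
proof -
  have "commutator G g c = inv (commutator G c g)"
    using g by (simp add: commutator_def inv_mult_group m_assoc)
  then show ?thesis
    using subgroup.m_inv_closed[OF subgroup_Z commutator_in_gamma3[OF c_in_D g]] by simp
qed

lemma y_in_Z: "y \<in> Z"
  by (rule commutator_c_in_Z) simp

lemma y_ne_one: "y \<noteq> \<one>"
  using a_notin_C commutator_one_iff[of a c] by (simp add: mem_C_iff)

lemma Z_eq: "Z = range (\<lambda>i::int. y [^] i)" and y_pow_p: "y [^] p = \<one>"
  using prime_order_subgroup_cyclic[OF p subgroup_Z card_Z y_in_Z y_ne_one] by auto

lemma y_central: "g \<in> carrier G \<Longrightarrow> g \<otimes> y = y \<otimes> g"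
  by (rule Z_central[OF _ y_in_Z])

text \<open>Some \<open>a\<^sup>-\<^sup>ib\<close> centralises \<open>G'\<close>, so its power with exponent \<open>p\<^sup>n\<^sup>-\<^sup>1\<close> is trivial modulo \<open>K\<close>; since \<open>b\<close>
  has smaller order than \<open>a\<close>, this forces \<open>p\<close> to divide \<open>i\<close>.\<close>

lemma bc: "b \<otimes> c = c \<otimes> b"
proof -
  obtain i :: int where i: "commutator G b c = y [^] i"
    using commutator_c_in_Z[OF b] Z_eq by blast
  interpret A: heisenberg_triple G a c y
    by (rule heisenberg_tripleI) (simp_all add: y_central)
  have "a [^] (-i) \<otimes> b \<in> C"
    unfolding mem_C_iff
  proof
    have 1: "b \<otimes> c = c \<otimes> b \<otimes> y [^] i"
      using i commutator_eq_iff[of b c "y [^] i"] by simp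
    have 2: "a [^] (-i) \<otimes> c = c \<otimes> a [^] (-i) \<otimes> y [^] (-i)"
      using A.pow_pow[of "-i" 1] by simp
    have 3: "y [^] (-i) \<otimes> (b \<otimes> y [^] i) = b"
    proof -
      have "y [^] (-i) \<otimes> b = b \<otimes> y [^] (-i)"
        using int_pow_comm[of y b "-i"] y_central[of b] by simp
      then have "y [^] (-i) \<otimes> (b \<otimes> y [^] i) = b \<otimes> (y [^] (-i) \<otimes> y [^] i)"
        by (simp add: m_assoc[symmetric])
      then show ?thesis
        by (simp add: int_pow_mult[symmetric])
    qed
    have "a [^] (-i) \<otimes> b \<otimes> c = (a [^] (-i) \<otimes> c) \<otimes> (b \<otimes> y [^] i)"
      by (simp add: m_assoc 1)
    also have "\<dots> = c \<otimes> (a [^] (-i) \<otimes> (y [^] (-i) \<otimes> (b \<otimes> y [^] i)))"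
      unfolding 2 by (simp add: m_assoc)
    finally show "a [^] (-i) \<otimes> b \<otimes> c = c \<otimes> (a [^] (-i) \<otimes> b)"
      unfolding 3 .
  qed simp
  then have "(a [^] (-i) \<otimes> b) [^] (p ^ (n - 1)) \<in> K"
    by (rule C_exponent)
  then have "\<pi> (a [^] (-i) \<otimes> b) [^]\<^bsub>Q\<^esub> (p ^ (n - 1)) = \<one>\<^bsub>Q\<^esub>"
    using \<pi>_one_iff[of "(a [^] (-i) \<otimes> b) [^] (p ^ (n - 1))"]
    by (simp add: \<pi>.hom_nat_pow del: \<pi>.hom_mult)
  moreover have "\<pi> (a [^] (-i) \<otimes> b) = Q.W (-i) 1 0"
    by (simp add: W_\<pi>)
  moreover have "Q.W (-i) 1 0 [^]\<^bsub>Q\<^esub> (p ^ (n - 1)) =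
      Q.W (-i * int p ^ (n - 1)) (int p ^ (n - 1)) (i * tri (int p ^ (n - 1)))"
    using Q.W_pow[of "-i" 1 0 "int (p ^ (n - 1))"] int_pow_int[of Q _ "p ^ (n - 1)"] by simp
  ultimately have W: "Q.W (-i * int p ^ (n - 1)) (int p ^ (n - 1)) (i * tri (int p ^ (n - 1))) = \<one>\<^bsub>Q\<^esub>"
    by argo
  have \<pi>b: "\<pi> b [^]\<^bsub>Q\<^esub> (int p ^ (n - 1)) = \<one>\<^bsub>Q\<^esub>"
    using \<pi>.H.int_pow_eq_id[OF \<pi>.hom_closed[OF b]] ord_\<pi>(2) m_less_n
    by (simp add: le_imp_power_dvd)
  have \<pi>c: "\<pi> c [^]\<^bsub>Q\<^esub> (i * tri (int p ^ (n - 1))) = \<one>\<^bsub>Q\<^esub>"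
  proof -
    have "\<pi> c [^]\<^bsub>Q\<^esub> p = \<one>\<^bsub>Q\<^esub>"
      using c_pow_p \<pi>_one_iff[of "c [^] p"] by (simp add: \<pi>.hom_nat_pow)
    moreover have "int p dvd i * tri (int p ^ (n - 1))"
      using dvd_tri[of "int p" "int p ^ (n - 1)"] odd_p m_less_n m_pos by (simp add: dvd_power)
    ultimately show ?thesis
      using \<pi>.H.int_pow_cong[of "\<pi> c" p "i * tri (int p ^ (n - 1))" 0] \<pi>.hom_closed[of c]
      by (simp add: cong_0_iff)
  qed
  have "\<pi> a [^]\<^bsub>Q\<^esub> (-i * int p ^ (n - 1)) = \<one>\<^bsub>Q\<^esub>"
    using W unfolding Q.W_def \<pi>b \<pi>c
    by (simp only: \<pi>.H.r_one \<pi>.H.int_pow_closed \<pi>.hom_closed a)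
  then have "int p ^ n dvd - i * int p ^ (n - 1)"
    using \<pi>.H.int_pow_eq_id[OF \<pi>.hom_closed[OF a], of "- i * int p ^ (n - 1)"] ord_\<pi>(1) by simp
  moreover have "int p ^ n = int p * int p ^ (n - 1)"
    using m_less_n by (simp flip: power_Suc)
  ultimately have "int p dvd i"
    using p_pos by simp
  then have "y [^] i = \<one>"
    using int_pow_cong[OF _ y_pow_p, of i 0] by (simp add: cong_0_iff)
  then show ?thesis
    using i commutator_one_iff[of b c] by simp
qed

text \<open>The centralizer has order p^(n+m+2) and misses \<open>a\<close>, so the order of G is a
  strictly larger power of p.\<close>

lemma order_ge: "p ^ (n + m + 3) \<le> order G"
proof -
  obtain r where r: "order G = p ^ r"
    using p_group by (auto simp: finite_p_group_def)
  have "card C < order G"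
    unfolding order_def using a_notin_C subgroup.subset[OF subgroup_C] fin
    by (intro psubset_card_mono) auto
  then have "n + m + 2 < r"
    unfolding card_C r by (rule power_less_imp_less_exp[OF prime_gt_1_nat[OF p]])
  then show ?thesis
    unfolding r using p_pos by (intro power_increasing) simp_all
qed

text \<open>Modulo \<open>Z\<close> the relation makes a power of \<open>c [^] p\<close> trivial; as
  \<open>c [^] p\<close> is outside \<open>Z\<close>, p divides i. Exponent p of \<open>K\<close>
  then removes \<open>c\<close>, leaving a relation on \<open>y\<close> alone.\<close>

lemma independent:
  assumes "c [^] (int p * i) \<otimes> y [^] (j::int) = \<one>"
  shows "int p dvd i \<and> int p dvd j"
proof -
  have pow_Z: "y [^] (j::int) \<in> Z" for j
    using subgroup_int_pow_closed[OF subgroup_Z y_in_Z] .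
  have cp: "c [^] (int p * i) = (c [^] p) [^] i"
    using int_pow_pow[of c "int p" i] by (simp add: int_pow_int)
  have "c [^] (int p * i) = inv (y [^] j)"
    using assms by (intro inv_equality[symmetric]) simp_all
  then have "(c [^] p) [^] i \<in> Z"
    using subgroup.m_inv_closed[OF subgroup_Z pow_Z] cp by simp
  then have i: "int p dvd i"
    using subgroup_int_pow_cancel[OF p p_group subgroup_Z, of "c [^] p" i] c_pow_p_notin_Z by auto
  then have "(c [^] p) [^] i = \<one>"
    using int_pow_cong[OF _ K_exponent[OF c_pow_p], of i 0] by (simp add: cong_0_iff)
  then have "y [^] j \<in> {\<one>}"
    using assms cp by simp
  then have "int p dvd j"
    using subgroup_int_pow_cancel[OF p p_group triv_subgroup, of y j] y_ne_one by auto
  with i show ?thesis ..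
qed

lemma span:
  assumes "g \<in> carrier G"
  shows "\<exists>(i::int) (j::int) (k::int) (l::int). g = a [^] i \<otimes> b [^] j \<otimes> c [^] k \<otimes> y [^] l"
proof -
  obtain i j k :: int and \<kappa> where g: "\<kappa> \<in> K" "g = a [^] i \<otimes> b [^] j \<otimes> c [^] k \<otimes> \<kappa>"
    using mod_K[OF assms] by blast
  then obtain k' :: int and u where "u \<in> Z" "\<kappa> = c [^] k' \<otimes> u"
    using frattini_gamma3_subset_derived D_mod_Z by blast
  moreover from this obtain l :: int where "u = y [^] l"
    unfolding Z_eq by blast
  ultimately have "g = a [^] i \<otimes> b [^] j \<otimes> c [^] (k + k') \<otimes> y [^] l"
    using g(2) by (simp add: m_assoc int_pow_mult)
  then show ?thesis by blast
qed

lemma metabelian_towerI: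
  assumes "a [^] (p ^ n) = c [^] (w11 * int p) \<otimes> y [^] (w12::int)"
    and "b [^] (p ^ m) = c [^] (w21 * int p) \<otimes> y [^] (w22::int)"
  shows "metabelian_tower G p n m a b c y w11 w12 w21 w22"
proof
  show "a \<otimes> b = b \<otimes> a \<otimes> c" "a \<otimes> c = c \<otimes> a \<otimes> y"
    using commutator_eq_iff[of a b c] commutator_eq_iff[of a c y] by simp_all
  have "c [^] (p * p) = \<one>"
    using K_exponent[OF c_pow_p] by (simp add: nat_pow_pow)
  then show "c [^] p\<^sup>2 = \<one>"
    by (simp add: power2_eq_square)
qed (use p odd_p p_group order_ge m_less_n bc y_central span independent y_pow_p assms in simp_all)

end

theorem theorem5p5:
  fixes p n m :: nat and G :: "('a, 'b) monoid_scheme" and w :: "int^2^2"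
  assumes "Factorial_Ring.prime p" and "odd p"
    and "finite_p_group p G"
    and "(G\<lparr>carrier := gamma3 G\<rparr>) \<cong> integer_mod_group p"
    and "(G\<lparr>carrier := frattini_gamma3 G\<rparr>) \<cong> (integer_mod_group p \<times>\<times> integer_mod_group p)"
    and "(G Mod frattini_gamma3 G) \<cong> Mp1 p n m"
    and "(G\<lparr>carrier := centralizer G (derived_subgroup G)\<rparr> Mod frattini_gamma3 G) \<cong>
           (integer_mod_group (p ^ (n - 1)) \<times>\<times> integer_mod_group (p ^ m) \<times>\<times> integer_mod_group p)"
    and "n > m"
    and "characteristic_matrix p n m G w"
  shows "(I_min p G \<ge> 2 \<and> \<not> (\<exists>H. A1_subgroup p H G \<and> card (rcosets\<^bsub>G\<^esub> H) = p))
    \<and> I_max p G \<ge> m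
    \<and> (I_max p G = 2 \<longleftrightarrow>
         m = 2 \<and>
         ((\<not> [w$1$2 = 0] (mod int p) \<and> \<not> [w$1$1 * det w = (w$1$2)^2] (mod int p))
          \<or> ([w$1$2 = 0] (mod int p) \<and> \<not> [w$1$1 = 0] (mod int p) \<and> \<not> [w$2$2 = 0] (mod int p))
          \<or> \<not> QuadRes (int p) ((w$2$1)^2 + 4 * w$2$2)))"
proof -
  obtain a b where gens: "char_generators p n m G a b"
    and a_pow: "a [^]\<^bsub>G\<^esub> (p ^ n) = commutator G a b [^]\<^bsub>G\<^esub> (w$1$1 * int p) \<otimes>\<^bsub>G\<^esub>
      commutator G a (commutator G a b) [^]\<^bsub>G\<^esub> (w$1$2)"
    and b_pow: "b [^]\<^bsub>G\<^esub> (p ^ m) = commutator G a b [^]\<^bsub>G\<^esub> (w$2$1 * int p) \<otimes>\<^bsub>G\<^esub>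
      commutator G a (commutator G a b) [^]\<^bsub>G\<^esub> (w$2$2)"
    using assms(9) by (auto simp: characteristic_matrix_def Let_def)
  have "group G"
    using assms(3) by (simp add: finite_p_group_def)
  then interpret S: char_generated G p n m a b
    using assms(1-5,7,8) gens by (simp add: char_generated_def char_generated_axioms_def)
  interpret T: metabelian_tower G p n m a b "commutator G a b" "commutator G a (commutator G a b)"
    "w$1$1" "w$1$2" "w$2$1" "w$2$2"
    by (rule S.metabelian_towerI[OF a_pow b_pow])
  show ?thesis
    using T.A1_index_bounds common_root_iff[OF assms(1,2), of "w$1$2" "w$1$1" "w$2$2" "w$2$1"]
    by (simp add: det_2)
qed

end
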